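(* Let $(M,\varphi,\xi,\eta,g)$ be a $3$-dimensional Sasaki-like almost contact B-metric manifold. If it admits a Ricci-like soliton with potential $v$ (an arbitrary vector field), then: (i) the sectional curvatures of its $\varphi$-holomorphic sections are equal to $-1$; (ii) the sectional curvatures of its $\xi$-sections are equal to $1$.
   Context: An almost contact B-metric manifold $(M,\varphi,\xi,\eta,g)$ is a differentiable manifold $M$ of dimension $2n+1$ with an endomorphism $\varphi$ of $TM$, a vector field $\xi$ (Reeb vector field), a 1-form $\eta$ and a pseudo-Riemannian metric $g$ of signature $(n+1,n)$ such that $\varphi\xi=0$, $\varphi^2=-\mathrm{id}+\eta\otimes\xi$, $\eta\circ\varphi=0$, $\eta(\xi)=1$ and $g(\varphi x,\varphi y)=-g(x,y)+\eta(x)\eta(y)$ for all vector fields $x,y$ (here $n=1$). The associated B-metric is $\tilde g(x,y)=g(x,\varphi y)+\eta(x)\eta(y)$. The manifold is called Sasaki-like if, with $\nabla$ the Levi-Civita connection of $g$, $(\nabla_x\varphi)y=-g(x,y)\xi-\eta(y)x+2\eta(x)\eta(y)\xi$ for all $x,y$. The curvature tensor is $R(x,y)z=\nabla_x\nabla_y z-\nabla_y\nabla_x z-\nabla_{[x,y]}z$, $R(x,y,z,w)=g(R(x,y)z,w)$, and the Ricci tensor of $g$ is $\rho(y,z)=g^{ij}R(e_i,y,z,e_j)$ for any local basis $\{e_i\}$. The manifold admits a Ricci-like soliton with potential vector field $v$ if there are real constants $(\lambda,\mu,\nu)$ with $\tfrac12\mathcal{L}_v g+\rho+\lambda\, g+\mu\,\tilde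 g+\nu\,\eta\otimes\eta=0$, where $\mathcal{L}$ is the Lie derivative. A section $\beta$ at $p\in M$ is a 2-plane in $T_pM$ that is non-degenerate with respect to $g$; for a basis $\{x,y\}$ of $\beta$ its sectional curvature is $k(\beta;p)=\dfrac{R(x,y,y,x)}{g(x,x)g(y,y)-[g(x,y)]^2}$. A section $\beta$ is $\varphi$-holomorphic if $\beta=\varphi\beta$; it is a $\xi$-section if it has a basis of the form $\{x,\xi\}$. *)

theory Defs
  imports "HOL-Analysis.Analysis" "HOL-Library.Function_Algebras"
begin

text \<open>
  Tangent vectors are real-valued functionals on functions, and vector fields are functions into
  tangent vectors. The pointwise real vector space structure on functions gives both of them
  their linear structure, so that \<^const>\<open>span\<close>, \<^const>\<open>independent\<close> and
  \<^const>\<open>dim\<close> apply.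
\<close>

instantiation "fun" :: (type, real_vector) real_vector
begin

definition scaleR_fun :: "real \<Rightarrow> ('a \<Rightarrow> 'b) \<Rightarrow> 'a \<Rightarrow> 'b" where
  "scaleR_fun c f = (\<lambda>x. c *\<^sub>R f x)"

instance
  by standard (simp_all add: scaleR_fun_def fun_eq_iff algebra_simps)

end


section \<open>Smooth manifolds, tangent vectors and vector fields\<close>

text \<open>Only used for open sets and maps between Euclidean spaces, where a map is
  \<open>C\<^sup>k\<^sup>+\<^sup>1\<close> iff it is differentiable with all directional derivatives
  \<open>C\<^sup>k\<close>.\<close>

primrec Ck_on :: "nat \<Rightarrow> 'a::euclidean_space set \<Rightarrow> ('a \<Rightarrow> 'b::euclidean_space) \<Rightarrow> bool" where
  "Ck_on 0 S f \<longleftrightarrow> continuous_on S f"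
| "Ck_on (Suc k) S f \<longleftrightarrow>
     (\<forall>x\<in>S. f differentiable (at x)) \<and> (\<forall>v. Ck_on k S (\<lambda>x. frechet_derivative f (at x) v))"

definition smooth_on :: "'a::euclidean_space set \<Rightarrow> ('a \<Rightarrow> 'b::euclidean_space) \<Rightarrow> bool" where
  "smooth_on S f \<longleftrightarrow> (\<forall>k. Ck_on k S f)"

text \<open>A chart is its domain together with its coordinate map; the values of the coordinate map
  outside the domain are irrelevant. The inverse coordinate map is \<^term>\<open>inv_into U h\<close>.\<close>

type_synonym ('m, 'e) chart = "'m set \<times> ('m \<Rightarrow> 'e)"

definition smooth_atlas ::
  "('m::{t2_space, second_countable_topology}, 'e::euclidean_space) chart set \<Rightarrow> bool" where
  "smooth_atlas A \<longleftrightarrow>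
     (\<Union>(U, h)\<in>A. U) = UNIV \<and>
     (\<forall>(U, h)\<in>A. open U \<and> open (h ` U) \<and> homeomorphism U (h ` U) h (inv_into U h)) \<and>
     (\<forall>(U, h)\<in>A. \<forall>(V, k)\<in>A. smooth_on (h ` (U \<inter> V)) (k \<circ> inv_into U h))"

definition smooth_fun :: "('m, 'e::euclidean_space) chart set \<Rightarrow> ('m \<Rightarrow> real) \<Rightarrow> bool" where
  "smooth_fun A f \<longleftrightarrow> (\<forall>(U, h)\<in>A. smooth_on (h ` U) (f \<circ> inv_into U h))"

text \<open>A tangent vector at \<open>p\<close> is a directional derivative operator
  \<open>\<Sum>\<^sub>i w\<^sup>i \<partial>/\<partial>x\<^sup>i\<close> at \<open>p\<close> on the smooth functions. The value 0 on
  functions that are not smooth makes the functional uniquely determined.\<close>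

type_synonym 'm tangent = "('m \<Rightarrow> real) \<Rightarrow> real"
type_synonym 'm vfield = "'m \<Rightarrow> 'm tangent"

definition tangent_space :: "('m, 'e::euclidean_space) chart set \<Rightarrow> 'm \<Rightarrow> 'm tangent set" where
  "tangent_space A p =
     {x. \<exists>(U, h)\<in>A. p \<in> U \<and>
        (\<exists>w. x = (\<lambda>f. if smooth_fun A f
                      then frechet_derivative (f \<circ> inv_into U h) (at (h p)) w else 0))}"

definition vector_field :: "('m, 'e::euclidean_space) chart set \<Rightarrow> 'm vfield \<Rightarrow> bool" where
  "vector_field A X \<longleftrightarrow>
     (\<forall>p. X p \<in> tangent_space A p) \<and> (\<forall>f. smooth_fun A f \<longrightarrow> smooth_fun A (\<lambda>p. X p f))"

text \<open>\<open>[X, Y] f = X (Y f) - Y (X f)\<close>; on a function that is not smooth, vector fields and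
  hence also the bracket give 0.\<close>

definition lie_bracket :: "'m vfield \<Rightarrow> 'm vfield \<Rightarrow> 'm vfield" where
  "lie_bracket X Y = (\<lambda>p f. X p (\<lambda>q. Y q f) - Y p (\<lambda>q. X q f))"


section \<open>Tensor fields and the Levi-Civita connection\<close>

definition linear_map_on ::
  "'v::real_vector set \<Rightarrow> ('v \<Rightarrow> 'w::real_vector) \<Rightarrow> bool" where
  "linear_map_on V f \<longleftrightarrow>
     (\<forall>x\<in>V. \<forall>y\<in>V. f (x + y) = f x + f y) \<and> (\<forall>c. \<forall>x\<in>V. f (c *\<^sub>R x) = c *\<^sub>R f x)"

definition ordered_basis :: "'v::real_vector set \<Rightarrow> nat \<Rightarrow> (nat \<Rightarrow> 'v) \<Rightarrow> bool" where
  "ordered_basis V m e \<longleftrightarrow>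
     inj_on e {..<m} \<and> independent (e ` {..<m}) \<and> span (e ` {..<m}) = V"

definition one_form ::
  "('m, 'e::euclidean_space) chart set \<Rightarrow> ('m \<Rightarrow> 'm tangent \<Rightarrow> real) \<Rightarrow> bool" where
  "one_form A \<eta> \<longleftrightarrow>
     (\<forall>p. linear_map_on (tangent_space A p) (\<eta> p)) \<and>
     (\<forall>X. vector_field A X \<longrightarrow> smooth_fun A (\<lambda>p. \<eta> p (X p)))"

definition tangent_endomorphism ::
  "('m, 'e::euclidean_space) chart set \<Rightarrow> ('m \<Rightarrow> 'm tangent \<Rightarrow> 'm tangent) \<Rightarrow> bool" where
  "tangent_endomorphism A \<phi> \<longleftrightarrow>
     (\<forall>p. linear_map_on (tangent_space A p) (\<phi> p) \<and>
          \<phi> p ` tangent_space A p \<subseteq> tangent_space A p) \<and>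
     (\<forall>X. vector_field A X \<longrightarrow> vector_field A (\<lambda>p. \<phi> p (X p)))"

type_synonym 'm metric = "'m \<Rightarrow> 'm tangent \<Rightarrow> 'm tangent \<Rightarrow> real"

text \<open>Pseudo-Riemannian metric of signature \<open>(r, s)\<close>: \<open>r\<close> positive and \<open>s\<close> negative directions.\<close>

definition pseudo_riemannian_metric ::
  "('m, 'e::euclidean_space) chart set \<Rightarrow> nat \<Rightarrow> nat \<Rightarrow> 'm metric \<Rightarrow> bool" where
  "pseudo_riemannian_metric A r s g \<longleftrightarrow>
     (\<forall>p. \<forall>x\<in>tangent_space A p. linear_map_on (tangent_space A p) (g p x)) \<and>
     (\<forall>p. \<forall>x\<in>tangent_space A p. \<forall>y\<in>tangent_space A p. g p x y = g p y x) \<and>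
     (\<forall>X Y. vector_field A X \<longrightarrow> vector_field A Y \<longrightarrow> smooth_fun A (\<lambda>p. g p (X p) (Y p))) \<and>
     (\<forall>p. \<exists>e. ordered_basis (tangent_space A p) (r + s) e \<and>
        (\<forall>i<r + s. \<forall>j<r + s.
           g p (e i) (e j) = (if i \<noteq> j then 0 else if i < r then 1 else - 1)))"

type_synonym 'm connection = "'m vfield \<Rightarrow> 'm vfield \<Rightarrow> 'm vfield"

definition affine_connection ::
  "('m, 'e::euclidean_space) chart set \<Rightarrow> 'm connection \<Rightarrow> bool" where
  "affine_connection A D \<longleftrightarrow>
     (\<forall>X Y. vector_field A X \<longrightarrow> vector_field A Y \<longrightarrow> vector_field A (D X Y)) \<and>
     (\<forall>X X' Y. vector_field A X \<longrightarrow> vector_field A X' \<longrightarrow> vector_field A Y \<longrightarrow>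
        D (X + X') Y = D X Y + D X' Y) \<and>
     (\<forall>X Y Y'. vector_field A X \<longrightarrow> vector_field A Y \<longrightarrow> vector_field A Y' \<longrightarrow>
        D X (Y + Y') = D X Y + D X Y') \<and>
     (\<forall>f X Y. smooth_fun A f \<longrightarrow> vector_field A X \<longrightarrow> vector_field A Y \<longrightarrow>
        D (\<lambda>p. f p *\<^sub>R X p) Y = (\<lambda>p. f p *\<^sub>R D X Y p) \<and>
        D X (\<lambda>p. f p *\<^sub>R Y p) = (\<lambda>p. X p f *\<^sub>R Y p + f p *\<^sub>R D X Y p))"

definition levi_civita_connection ::
  "('m, 'e::euclidean_space) chart set \<Rightarrow> 'm metric \<Rightarrow> 'm connection \<Rightarrow> bool" where
  "levi_civita_connection A g D \<longleftrightarrow>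
     affine_connection A D \<and>
     (\<forall>X Y. vector_field A X \<longrightarrow> vector_field A Y \<longrightarrow> D X Y - D Y X = lie_bracket X Y) \<and>
     (\<forall>X Y Z. vector_field A X \<longrightarrow> vector_field A Y \<longrightarrow> vector_field A Z \<longrightarrow>
        (\<forall>p. X p (\<lambda>q. g q (Y q) (Z q)) = g p (D X Y p) (Z p) + g p (Y p) (D X Z p)))"


section \<open>Curvature\<close>

definition curvature_field :: "'m connection \<Rightarrow> 'm vfield \<Rightarrow> 'm vfield \<Rightarrow> 'm vfield \<Rightarrow> 'm vfield" where
  "curvature_field D X Y Z = D X (D Y Z) - D Y (D X Z) - D (lie_bracket X Y) Z"

text \<open>The curvature operator \<open>R(x, y) z\<close> on tangent vectors at \<open>p\<close>: the common value at
  \<open>p\<close> of \<^const>\<open>curvature_field\<close> for all vector fields extending \<open>x\<close>, \<open>y\<close>, \<open>z\<close>.\<close>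

definition curvature_at ::
  "('m, 'e::euclidean_space) chart set \<Rightarrow> 'm connection \<Rightarrow> 'm \<Rightarrow>
    'm tangent \<Rightarrow> 'm tangent \<Rightarrow> 'm tangent \<Rightarrow> 'm tangent" where
  "curvature_at A D p x y z =
     (THE u. \<exists>X Y Z. vector_field A X \<and> vector_field A Y \<and> vector_field A Z \<and>
        X p = x \<and> Y p = y \<and> Z p = z \<and> u = curvature_field D X Y Z p)"

definition curvature4 ::
  "('m, 'e::euclidean_space) chart set \<Rightarrow> 'm metric \<Rightarrow> 'm connection \<Rightarrow> 'm \<Rightarrow>
    'm tangent \<Rightarrow> 'm tangent \<Rightarrow> 'm tangent \<Rightarrow> 'm tangent \<Rightarrow> real" where
  "curvature4 A g D p x y z w = g p (curvature_at A D p x y z) w"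

text \<open>\<open>\<rho>(y, z) = g\<^sup>i\<^sup>j R(e\<^sub>i, y, z, e\<^sub>j)\<close>, the common value for all bases \<open>e\<close> of the tangent
  space; \<open>G\<close> is the inverse of the Gram matrix of \<open>e\<close>.\<close>

definition ricci ::
  "('m, 'e::euclidean_space) chart set \<Rightarrow> 'm metric \<Rightarrow> 'm connection \<Rightarrow> 'm \<Rightarrow>
    'm tangent \<Rightarrow> 'm tangent \<Rightarrow> real" where
  "ricci A g D p y z =
     (THE r. \<exists>e G. ordered_basis (tangent_space A p) DIM('e) e \<and>
        (\<forall>i<DIM('e). \<forall>k<DIM('e).
           (\<Sum>j<DIM('e). G i j * g p (e j) (e k)) = (if i = k then 1 else 0)) \<and>
        r = (\<Sum>i<DIM('e). \<Sum>j<DIM('e). G i j * curvature4 A g D p (e i) y z (e j)))"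

definition is_section ::
  "('m, 'e::euclidean_space) chart set \<Rightarrow> 'm metric \<Rightarrow> 'm \<Rightarrow> 'm tangent set \<Rightarrow> bool" where
  "is_section A g p \<beta> \<longleftrightarrow>
     \<beta> \<subseteq> tangent_space A p \<and> subspace \<beta> \<and> dim \<beta> = 2 \<and>
     (\<forall>x\<in>\<beta>. (\<forall>y\<in>\<beta>. g p x y = 0) \<longrightarrow> x = 0)"

definition basis_pair :: "'v::real_vector set \<Rightarrow> 'v \<Rightarrow> 'v \<Rightarrow> bool" where
  "basis_pair \<beta> x y \<longleftrightarrow> x \<noteq> y \<and> independent {x, y} \<and> span {x, y} = \<beta>"

definition sectional_curvature ::
  "('m, 'e::euclidean_space) chart set \<Rightarrow> 'm metric \<Rightarrow> 'm connection \<Rightarrow> 'm \<Rightarrow>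
    'm tangent set \<Rightarrow> real" where
  "sectional_curvature A g D p \<beta> =
     (THE k. \<exists>x y. basis_pair \<beta> x y \<and>
        k = curvature4 A g D p x y y x / (g p x x * g p y y - (g p x y)\<^sup>2))"


section \<open>Almost contact B-metric manifolds\<close>

definition almost_contact_B_metric ::
  "('m::{t2_space, second_countable_topology}, 'e::euclidean_space) chart set \<Rightarrow>
    ('m \<Rightarrow> 'm tangent \<Rightarrow> 'm tangent) \<Rightarrow> 'm vfield \<Rightarrow> ('m \<Rightarrow> 'm tangent \<Rightarrow> real) \<Rightarrow> 'm metric \<Rightarrow> bool" where
  "almost_contact_B_metric A \<phi> \<xi> \<eta> g \<longleftrightarrow>
     smooth_atlas A \<and> tangent_endomorphism A \<phi> \<and> vector_field A \<xi> \<and> one_form A \<eta> \<and>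
     (\<exists>n. DIM('e) = 2 * n + 1 \<and> pseudo_riemannian_metric A (n + 1) n g) \<and>
     (\<forall>p. \<phi> p (\<xi> p) = 0 \<and> \<eta> p (\<xi> p) = 1) \<and>
     (\<forall>p. \<forall>x\<in>tangent_space A p.
        \<phi> p (\<phi> p x) = - x + \<eta> p x *\<^sub>R \<xi> p \<and> \<eta> p (\<phi> p x) = 0) \<and>
     (\<forall>p. \<forall>x\<in>tangent_space A p. \<forall>y\<in>tangent_space A p.
        g p (\<phi> p x) (\<phi> p y) = - g p x y + \<eta> p x * \<eta> p y)"

definition associated_B_metric ::
  "('m \<Rightarrow> 'm tangent \<Rightarrow> 'm tangent) \<Rightarrow> ('m \<Rightarrow> 'm tangent \<Rightarrow> real) \<Rightarrow> 'm metric \<Rightarrow> 'm metric" where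
  "associated_B_metric \<phi> \<eta> g = (\<lambda>p x y. g p x (\<phi> p y) + \<eta> p x * \<eta> p y)"

text \<open>\<open>(\<nabla>\<^sub>X \<phi>) Y = \<nabla>\<^sub>X (\<phi> Y) - \<phi> (\<nabla>\<^sub>X Y)\<close>\<close>

definition sasaki_like ::
  "('m, 'e::euclidean_space) chart set \<Rightarrow> ('m \<Rightarrow> 'm tangent \<Rightarrow> 'm tangent) \<Rightarrow> 'm vfield \<Rightarrow>
    ('m \<Rightarrow> 'm tangent \<Rightarrow> real) \<Rightarrow> 'm metric \<Rightarrow> 'm connection \<Rightarrow> bool" where
  "sasaki_like A \<phi> \<xi> \<eta> g D \<longleftrightarrow>
     (\<forall>X Y. vector_field A X \<longrightarrow> vector_field A Y \<longrightarrow>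
        (\<forall>p. D X (\<lambda>q. \<phi> q (Y q)) p - \<phi> p (D X Y p) =
           - (g p (X p) (Y p) *\<^sub>R \<xi> p) - \<eta> p (Y p) *\<^sub>R X p
             + (2 * \<eta> p (X p) * \<eta> p (Y p)) *\<^sub>R \<xi> p))"

definition lie_derivative_metric :: "'m vfield \<Rightarrow> 'm metric \<Rightarrow> 'm vfield \<Rightarrow> 'm vfield \<Rightarrow> 'm \<Rightarrow> real" where
  "lie_derivative_metric v g X Y p =
     v p (\<lambda>q. g q (X q) (Y q)) - g p (lie_bracket v X p) (Y p) - g p (X p) (lie_bracket v Y p)"

definition ricci_like_soliton ::
  "('m, 'e::euclidean_space) chart set \<Rightarrow> ('m \<Rightarrow> 'm tangent \<Rightarrow> 'm tangent) \<Rightarrow>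
    ('m \<Rightarrow> 'm tangent \<Rightarrow> real) \<Rightarrow> 'm metric \<Rightarrow> 'm connection \<Rightarrow> 'm vfield \<Rightarrow>
    real \<Rightarrow> real \<Rightarrow> real \<Rightarrow> bool" where
  "ricci_like_soliton A \<phi> \<eta> g D v lam mu nu \<longleftrightarrow>
     (\<forall>X Y. vector_field A X \<longrightarrow> vector_field A Y \<longrightarrow>
        (\<forall>p. 1 / 2 * lie_derivative_metric v g X Y p + ricci A g D p (X p) (Y p)
             + lam * g p (X p) (Y p) + mu * associated_B_metric \<phi> \<eta> g p (X p) (Y p)
             + nu * (\<eta> p (X p) * \<eta> p (Y p)) = 0))"

definition phi_holomorphic ::
  "('m \<Rightarrow> 'm tangent \<Rightarrow> 'm tangent) \<Rightarrow> 'm \<Rightarrow> 'm tangent set \<Rightarrow> bool" where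
  "phi_holomorphic \<phi> p \<beta> \<longleftrightarrow> \<beta> = \<phi> p ` \<beta>"

definition xi_section :: "'m vfield \<Rightarrow> 'm \<Rightarrow> 'm tangent set \<Rightarrow> bool" where
  "xi_section \<xi> p \<beta> \<longleftrightarrow> (\<exists>x. basis_pair \<beta> x (\<xi> p))"

end

theory Submission
  imports Defs
begin

text \<open>
  The Sasaki-like condition fixes the curvature tensor of a \<open>3\<close>-dimensional manifold, pointwise
  and algebraically, and both sectional curvatures can be read off from the result.

  Putting \<open>y = \<xi>\<close> in the condition gives \<open>\<nabla>\<^sub>x \<xi> = - \<phi> x\<close>. Differentiating once more yields
  \<open>R(x, y) \<xi> = \<eta>(y) x - \<eta>(x) y\<close> (lemma \<open>curvature_\<xi>\<close>) and, by the Ricci identity, an explicit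
  expression for the commutator \<open>R(x, y) \<phi> z - \<phi> (R(x, y) z)\<close> (lemma \<open>curvature_\<phi>\<close>); moreover
  \<open>R(x, y)\<close> is skew with respect to \<open>g\<close> (lemma \<open>curvature_skew\<close>). The tensor
  \<open>- (g(y, z) x - g(x, z) y)
    + 2 (\<eta>(y) \<eta>(z) x - \<eta>(x) \<eta>(z) y + \<eta>(x) g(y, z) \<xi> - \<eta>(y) g(x, z) \<xi>)\<close>
  has the same three properties. The difference \<open>T\<close> of the two is therefore skew, kills \<open>\<xi>\<close> and
  commutes with \<open>\<phi>\<close>. Since \<open>\<phi>\<close> is self-adjoint for \<open>g\<close>, \<open>T z\<close> is orthogonal to \<open>z\<close>, to \<open>\<phi> z\<close> and
  to \<open>\<xi>\<close>. In dimension \<open>3\<close> these span the tangent space whenever \<open>z\<close> is not a multiple of \<open>\<xi>\<close>, so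
  \<open>T = 0\<close> (lemma \<open>model_curvature_eqI\<close>).

  For a basis \<open>a, b\<close> of a section with Gram determinant \<open>N\<close>, the tensor above gives
  \<open>R(a, b, b, a) = - N + 2 g(u, u)\<close> with \<open>u = \<eta>(b) a - \<eta>(a) b\<close>. A \<open>\<phi>\<close>-holomorphic section lies in
  the kernel of \<open>\<eta>\<close>, so \<open>u = 0\<close> and the sectional curvature is \<open>-1\<close>; if the section contains \<open>\<xi>\<close>,
  then \<open>g(u, u) = N\<close> and it is \<open>1\<close>.

  The curvature operator on tangent vectors is the common value over all extensions to vector
  fields, so extensions must exist. They are built in a chart with a smooth bump function, which
  in turn needs the product rule and the chain rule for maps of class \<open>C\<^sup>k\<close>.
\<close>

section \<open>Calculus of maps of class \<open>C\<^sup>k\<close>\<close>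

lemma Ck_on_subset:
  assumes "Ck_on k S f" and "T \<subseteq> S"
  shows "Ck_on k T f"
  using assms
  by (induction k arbitrary: f) (auto intro: continuous_on_subset)

lemma Ck_on_cong:
  assumes "open S" and "\<And>x. x \<in> S \<Longrightarrow> f x = f' x" and "Ck_on k S f"
  shows "Ck_on k S f'"
  using assms(2,3)
proof (induction k arbitrary: f f')
  case 0
  then show ?case
    by (simp cong: continuous_on_cong)
next
  case (Suc k)
  have der: "(f' has_derivative frechet_derivative f (at x)) (at x)" if "x \<in> S" for x
  proof (rule has_derivative_transform_within_open[OF _ \<open>open S\<close> that])
    show "(f has_derivative frechet_derivative f (at x)) (at x)"
      using Suc.prems(2) that frechet_derivative_works by auto
  qed (rule Suc.prems(1))
  have "Ck_on k S (\<lambda>x. frechet_derivative f' (at x) v)" for v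
  proof (rule Suc.IH)
    show "frechet_derivative f (at x) v = frechet_derivative f' (at x) v" if "x \<in> S" for x
      using frechet_derivative_at[OF der[OF that]] by metis
    show "Ck_on k S (\<lambda>x. frechet_derivative f (at x) v)"
      using Suc.prems(2) by simp
  qed
  then show ?case
    using der unfolding Ck_on.simps differentiable_def by blast
qed

lemma Ck_on_local:
  assumes "\<And>x. x \<in> S \<Longrightarrow> \<exists>T. open T \<and> x \<in> T \<and> Ck_on k T f"
  shows "Ck_on k S f"
  using assms
proof (induction k arbitrary: f)
  case 0
  have "continuous (at x within S) f" if x: "x \<in> S" for x
  proof -
    obtain T where "open T" "x \<in> T" "continuous_on T f"
      using 0[OF x] unfolding Ck_on.simps by blast
    then have "continuous (at x) f"
      by (simp add: continuous_on_eq_continuous_at)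
    then show ?thesis
      by (rule continuous_at_imp_continuous_at_within)
  qed
  then show ?case
    unfolding Ck_on.simps continuous_on_eq_continuous_within by blast
next
  case (Suc k)
  show ?case
    unfolding Ck_on.simps
  proof (intro conjI ballI allI)
    show "f differentiable (at x)" if "x \<in> S" for x
      using Suc.prems[OF that] unfolding Ck_on.simps by blast
    show "Ck_on k S (\<lambda>x. frechet_derivative f (at x) v)" for v
    proof (rule Suc.IH)
      fix x assume "x \<in> S"
      from Suc.prems[OF this]
      show "\<exists>T. open T \<and> x \<in> T \<and> Ck_on k T (\<lambda>x. frechet_derivative f (at x) v)"
        unfolding Ck_on.simps by blast
    qed
  qed
qed

lemma Ck_on_Suc_imp: "Ck_on (Suc k) S f \<Longrightarrow> Ck_on k S f"
proof (induction k arbitrary: f)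
  case 0
  then show ?case
    by (simp add: differentiable_at_withinI differentiable_imp_continuous_on differentiable_on_def)
next
  case (Suc k)
  then show ?case
    by (metis Ck_on.simps(2))
qed

lemma Ck_on_SucI:
  assumes "open S"
    and "\<And>x. x \<in> S \<Longrightarrow> (f has_derivative f' x) (at x)"
    and "\<And>v. Ck_on k S (\<lambda>x. f' x v)"
  shows "Ck_on (Suc k) S f"
proof -
  have "Ck_on k S (\<lambda>x. frechet_derivative f (at x) v)" for v
    by (rule Ck_on_cong[OF \<open>open S\<close> _ assms(3)[of v]])
      (use assms(2) frechet_derivative_at in metis)
  then show ?thesis
    using assms(2) by (auto simp: differentiable_def)
qed

lemma Ck_on_has_derivative:
  assumes "Ck_on (Suc k) S f" and "x \<in> S"
  shows "(f has_derivative frechet_derivative f (at x)) (at x)"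
  using assms by (auto simp flip: frechet_derivative_works)

lemma Ck_on_const: "open S \<Longrightarrow> Ck_on k S (\<lambda>x. c)"
proof (induction k arbitrary: c)
  case (Suc k)
  then show ?case
    by (intro Ck_on_SucI[where f' = "\<lambda>x v. 0"]) auto
qed auto

lemma Ck_on_bounded_linear:
  assumes "open S" and "bounded_linear L" and "Ck_on k S f"
  shows "Ck_on k S (\<lambda>x. L (f x))"
  using assms(3)
proof (induction k arbitrary: f)
  case 0
  then show ?case
    using bounded_linear.continuous_on[OF assms(2)] by auto
next
  case (Suc k)
  then show ?case
    by (intro Ck_on_SucI[OF assms(1)
          bounded_linear.has_derivative[OF assms(2) Ck_on_has_derivative[OF Suc.prems]]]) auto
qed

lemma Ck_on_linear:
  assumes "open S" and "bounded_linear L"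
  shows "Ck_on k S L"
proof (cases k)
  case 0
  then show ?thesis
    using linear_continuous_on[OF assms(2)] by simp
next
  case (Suc j)
  then show ?thesis
    using Ck_on_SucI[OF assms(1) bounded_linear_imp_has_derivative[OF assms(2)]]
      Ck_on_const[OF assms(1)] by auto
qed

lemma Ck_on_add:
  assumes "open S" and "Ck_on k S f" and "Ck_on k S f'"
  shows "Ck_on k S (\<lambda>x. f x + f' x)"
  using assms(2,3)
proof (induction k arbitrary: f f')
  case (Suc k)
  then show ?case
    by (intro Ck_on_SucI[OF assms(1)
          has_derivative_add[OF Ck_on_has_derivative[OF Suc.prems(1)]
            Ck_on_has_derivative[OF Suc.prems(2)]]]) auto
qed (auto intro: continuous_intros)

lemma Ck_on_mult:
  fixes f f' :: "'a::euclidean_space \<Rightarrow> real"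
  assumes "open S" and "Ck_on k S f" and "Ck_on k S f'"
  shows "Ck_on k S (\<lambda>x. f x * f' x)"
  using assms(2,3)
proof (induction k arbitrary: f f')
  case (Suc k)
  have "Ck_on k S f" "Ck_on k S f'"
    using Suc.prems Ck_on_Suc_imp by blast+
  with Suc show ?case
    by (intro Ck_on_SucI[OF assms(1)
          has_derivative_mult[OF Ck_on_has_derivative[OF Suc.prems(1)]
            Ck_on_has_derivative[OF Suc.prems(2)]]] Ck_on_add[OF assms(1)] Suc.IH) auto
qed (auto intro: continuous_intros)

lemma Ck_on_sum:
  assumes "open S" and "finite I" and "\<And>i. i \<in> I \<Longrightarrow> Ck_on k S (f i)"
  shows "Ck_on k S (\<lambda>x. \<Sum>i\<in>I. f i x)"
  using assms(2,3)
  by (induction I) (auto intro: Ck_on_const Ck_on_add assms(1))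

text \<open>
  The chain rule has to be written in coordinates, as a sum of products of real functions, so that
  both factors are again of a form to which the induction hypothesis and the product rule apply.
\<close>

lemma Ck_on_compose:
  fixes f :: "'b::euclidean_space \<Rightarrow> real" and u :: "'a::euclidean_space \<Rightarrow> 'b"
  assumes "open S" and "u ` S \<subseteq> T" and "Ck_on k T f" and "Ck_on k S u"
  shows "Ck_on k S (\<lambda>x. f (u x))"
  using assms(3,4)
proof (induction k arbitrary: f)
  case 0
  then show ?case
    unfolding Ck_on.simps using assms(2) by (rule continuous_on_compose2)
next
  case (Suc k)
  have u: "Ck_on k S u"
    using Suc.prems Ck_on_Suc_imp by blast
  have f: "(f has_derivative frechet_derivative f (at (u x))) (at (u x))" if "x \<in> S" for x
    using Ck_on_has_derivative[OF Suc.prems(1)] that assms(2) by blast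
  show ?case
  proof (rule Ck_on_SucI[OF assms(1)])
    fix x assume x: "x \<in> S"
    show "((\<lambda>x. f (u x)) has_derivative
        (\<lambda>v. \<Sum>b\<in>Basis. (frechet_derivative u (at x) v \<bullet> b) * frechet_derivative f (at (u x)) b))
        (at x)"
    proof -
      have lin: "linear (frechet_derivative f (at (u x)))"
        using f[OF x] has_derivative_linear by blast
      have expand: "frechet_derivative f (at (u x)) w =
          (\<Sum>b\<in>Basis. (w \<bullet> b) * frechet_derivative f (at (u x)) b)" for w
      proof -
        have "frechet_derivative f (at (u x)) w =
            frechet_derivative f (at (u x)) (\<Sum>b\<in>Basis. (w \<bullet> b) *\<^sub>R b)"
          by (simp only: euclidean_representation)
        also have "\<dots> = (\<Sum>b\<in>Basis. frechet_derivative f (at (u x)) ((w \<bullet> b) *\<^sub>R b))"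
          by (rule linear_sum[OF lin])
        finally show ?thesis
          by (simp only: linear_cmul[OF lin] real_scaleR_def)
      qed
      show ?thesis
        unfolding expand[of "frechet_derivative u (at x) _", symmetric]
        by (rule has_derivative_compose[OF Ck_on_has_derivative[OF Suc.prems(2) x] f[OF x]])
    qed
  next
    fix v
    show "Ck_on k S (\<lambda>x. \<Sum>b\<in>Basis. (frechet_derivative u (at x) v \<bullet> b) *
        frechet_derivative f (at (u x)) b)"
    proof (intro Ck_on_sum Ck_on_mult assms(1) finite_Basis)
      fix b :: 'b
      show "Ck_on k S (\<lambda>x. frechet_derivative u (at x) v \<bullet> b)"
        using Suc.prems(2) unfolding Ck_on.simps
        by (intro Ck_on_bounded_linear[OF assms(1) bounded_linear_inner_left]) blast
      show "Ck_on k S (\<lambda>x. frechet_derivative f (at (u x)) b)"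
        using Suc.prems(1) unfolding Ck_on.simps by (intro Suc.IH u) blast
    qed
  qed
qed


section \<open>Bump functions\<close>

text \<open>
  The derivatives of \<open>exp (- 1 / t)\<close> have the form \<open>p (1 / t) exp (- 1 / t)\<close> with polynomials \<open>p\<close>.
  Treating all \<open>p\<close> at once makes the family closed under differentiation.
\<close>

definition flat_exp :: "real poly \<Rightarrow> real \<Rightarrow> real" where
  "flat_exp p t = (if t > 0 then poly p (1 / t) * exp (- (1 / t)) else 0)"

lemma poly_exp_decay: "((\<lambda>u::real. poly p u * exp (- u)) \<longlongrightarrow> 0) at_top"
proof -
  have "((\<lambda>u. \<Sum>i\<le>degree p. coeff p i * (u ^ i / exp u)) \<longlongrightarrow> (\<Sum>i\<le>degree p. coeff p i * 0)) at_top"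
    by (intro tendsto_sum tendsto_mult tendsto_const tendsto_power_div_exp_0)
  then show ?thesis
    by (simp add: poly_altdef exp_minus divide_inverse sum_distrib_right mult.assoc)
qed

text \<open>
  At \<open>0\<close> the difference quotient is again of the form \<open>q (u) exp (- u)\<close> with \<open>u = 1 / t \<rightarrow> \<infinity>\<close>,
  where \<open>q = u p\<close>; elsewhere this is the product rule, and the factor \<open>u\<^sup>2\<close> comes from
  \<open>d u / d t = - u\<^sup>2\<close>.
\<close>

lemma flat_exp_has_derivative:
  "(flat_exp p has_real_derivative flat_exp ([:0, 0, 1:] * (p - pderiv p)) t) (at t)"
proof (cases t "0::real" rule: linorder_cases)
  case less
  have "((\<lambda>t. 0) has_real_derivative 0) (at t)"
    by simp
  then have "(flat_exp p has_real_derivative 0) (at t)"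
    by (rule has_field_derivative_transform_within_open[where S = "{..<0}"])
      (use less in \<open>auto simp: flat_exp_def\<close>)
  with less show ?thesis
    by (simp add: flat_exp_def)
next
  case equal
  have "((\<lambda>u. poly (pCons 0 p) u * exp (- u)) \<longlongrightarrow> 0) at_top"
    by (rule poly_exp_decay)
  from filterlim_compose[OF this filterlim_inverse_at_top_right]
  have "((\<lambda>h. flat_exp p h / h) \<longlongrightarrow> 0) (at_right 0)"
    by (rule Lim_transform_eventually)
      (auto simp: flat_exp_def eventually_at_right_less field_simps
        intro!: eventually_at_rightI[of 0 1])
  moreover have "((\<lambda>h. flat_exp p h / h) \<longlongrightarrow> 0) (at_left 0)"
    by (rule Lim_transform_eventually[OF tendsto_const])
      (auto simp: flat_exp_def intro!: eventually_at_leftI[of "-1" 0])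
  ultimately have "((\<lambda>h. flat_exp p h / h) \<longlongrightarrow> 0) (at 0)"
    by (simp add: filterlim_at_split)
  then show ?thesis
    using equal by (simp add: DERIV_def flat_exp_def)
next
  case greater
  have "((\<lambda>t. poly p (1 / t) * exp (- (1 / t))) has_real_derivative
      flat_exp ([:0, 0, 1:] * (p - pderiv p)) t) (at t)"
    using greater
    by (auto intro!: derivative_eq_intros
        simp: flat_exp_def power2_eq_square field_simps)
  then show ?thesis
    by (rule has_field_derivative_transform_within_open[where S = "{0<..}"])
      (use greater in \<open>auto simp: flat_exp_def\<close>)
qed

lemma Ck_on_flat_exp: "Ck_on k UNIV (flat_exp p)"
proof (induction k arbitrary: p)
  case 0
  show ?case
    by (simp add: DERIV_continuous_on[OF has_field_derivative_at_within[OF flat_exp_has_derivative]])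
next
  case (Suc k)
  show ?case
    by (rule Ck_on_SucI[OF open_UNIV
          flat_exp_has_derivative[unfolded has_field_derivative_def]])
      (intro Ck_on_mult Ck_on_const Suc.IH open_UNIV)
qed

text \<open>
  The function is a multiple of \<open>exp (- 1 / s)\<close>, extended by \<open>0\<close>, where \<open>s = r\<^sup>2 - dist a x\<^sup>2\<close> is
  positive exactly in the open ball.
\<close>

lemma exists_bump_function:
  fixes a :: "'e::euclidean_space"
  assumes "r > 0"
  obtains b :: "'e \<Rightarrow> real"
  where "smooth_on UNIV b" and "b a = 1" and "\<And>x. x \<notin> cball a r \<Longrightarrow> b x = 0"
proof
  \<comment> \<open>A sum of products of coordinates, to which the rules for sums and products apply directly.\<close>
  define s :: "'e \<Rightarrow> real"
    where "s = (\<lambda>x. r\<^sup>2 + (\<Sum>i\<in>Basis. - 1 * ((x \<bullet> i + - (a \<bullet> i)) * (x \<bullet> i + - (a \<bullet> i)))))"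
  have s: "s x = r\<^sup>2 - (dist a x)\<^sup>2" for x
  proof -
    have "(dist a x)\<^sup>2 = (\<Sum>i\<in>Basis. (x \<bullet> i - a \<bullet> i) * (x \<bullet> i - a \<bullet> i))"
      unfolding dist_norm norm_minus_commute[of a] power2_norm_eq_inner
      by (subst euclidean_inner) (simp add: inner_diff_left)
    then show ?thesis
      by (simp add: s_def sum_negf)
  qed
  have coord: "Ck_on k UNIV (\<lambda>x. x \<bullet> i + - (a \<bullet> i))" for k and i :: 'e
    by (rule Ck_on_add[OF open_UNIV Ck_on_linear[OF open_UNIV bounded_linear_inner_left]
          Ck_on_const[OF open_UNIV]])
  have "Ck_on k UNIV s" for k
    unfolding s_def
    by (rule Ck_on_add[OF open_UNIV Ck_on_const[OF open_UNIV] Ck_on_sum[OF open_UNIV finite_Basis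
          Ck_on_mult[OF open_UNIV Ck_on_const[OF open_UNIV] Ck_on_mult[OF open_UNIV coord coord]]]])
  then have "Ck_on k UNIV (\<lambda>x. flat_exp 1 (s x))" for k
    by (rule Ck_on_compose[OF open_UNIV subset_UNIV Ck_on_flat_exp])
  then show "smooth_on UNIV (\<lambda>x. exp (1 / r\<^sup>2) * flat_exp 1 (s x))"
    unfolding smooth_on_def by (intro allI Ck_on_mult[OF open_UNIV Ck_on_const[OF open_UNIV]])
  show "exp (1 / r\<^sup>2) * flat_exp 1 (s a) = 1"
    using assms by (simp add: s flat_exp_def flip: exp_add)
  show "exp (1 / r\<^sup>2) * flat_exp 1 (s x) = 0" if "x \<notin> cball a r" for x
  proof -
    have "r\<^sup>2 < (dist a x)\<^sup>2"
      using that assms by (intro power_strict_mono) auto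
    then show ?thesis
      by (simp add: s flat_exp_def)
  qed
qed

section \<open>Smooth functions and extension of tangent vectors\<close>

lemma smooth_atlas_cover:
  assumes "smooth_atlas A"
  obtains U h where "(U, h) \<in> A" and "p \<in> U"
proof -
  have "p \<in> (\<Union>(U, h)\<in>A. U)"
    using assms unfolding smooth_atlas_def by simp
  then show ?thesis
    using that by blast
qed

lemma smooth_atlas_chart:
  assumes "smooth_atlas A" and "(U, h) \<in> A"
  shows "open U" and "open (h ` U)" and "homeomorphism U (h ` U) h (inv_into U h)"
  using assms unfolding smooth_atlas_def by blast+

lemma smooth_atlas_transition:
  assumes "smooth_atlas A" and "(U, h) \<in> A" and "(V, k) \<in> A"
  shows "Ck_on j (h ` (U \<inter> V)) (k \<circ> inv_into U h)"
  using assms unfolding smooth_atlas_def smooth_on_def by blast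

lemma smooth_fun_chart:
  "smooth_fun A f \<Longrightarrow> (U, h) \<in> A \<Longrightarrow> Ck_on k (h ` U) (f \<circ> inv_into U h)"
  unfolding smooth_fun_def smooth_on_def by blast

lemma smooth_funI:
  "(\<And>U h k. (U, h) \<in> A \<Longrightarrow> Ck_on k (h ` U) (f \<circ> inv_into U h)) \<Longrightarrow> smooth_fun A f"
  unfolding smooth_fun_def smooth_on_def by blast

lemma smooth_fun_const:
  assumes "smooth_atlas A"
  shows "smooth_fun A (\<lambda>p. c)"
  by (rule smooth_funI)
    (simp only: comp_def Ck_on_const smooth_atlas_chart(2)[OF assms])

lemma smooth_fun_add:
  assumes "smooth_atlas A" and "smooth_fun A f" and "smooth_fun A f'"
  shows "smooth_fun A (\<lambda>p. f p + f' p)"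
proof (rule smooth_funI)
  fix U h k assume U: "(U, h) \<in> A"
  show "Ck_on k (h ` U) ((\<lambda>p. f p + f' p) \<circ> inv_into U h)"
    using Ck_on_add[OF smooth_atlas_chart(2)[OF assms(1) U]
        smooth_fun_chart[OF assms(2) U] smooth_fun_chart[OF assms(3) U]]
    by (simp only: comp_def)
qed

lemma smooth_fun_mult:
  assumes "smooth_atlas A" and "smooth_fun A f" and "smooth_fun A f'"
  shows "smooth_fun A (\<lambda>p. f p * f' p)"
proof (rule smooth_funI)
  fix U h k assume U: "(U, h) \<in> A"
  show "Ck_on k (h ` U) ((\<lambda>p. f p * f' p) \<circ> inv_into U h)"
    using Ck_on_mult[OF smooth_atlas_chart(2)[OF assms(1) U]
        smooth_fun_chart[OF assms(2) U] smooth_fun_chart[OF assms(3) U]]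
    by (simp only: comp_def)
qed

lemma smooth_fun_differentiable:
  assumes "smooth_fun A f" and "(U, h) \<in> A" and "p \<in> U"
  shows "(f \<circ> inv_into U h) differentiable (at (h p))"
  using smooth_fun_chart[OF assms(1,2), of "Suc 0"] assms(3) unfolding Ck_on.simps by blast

lemma tangent_add:
  assumes "smooth_atlas A" and "x \<in> tangent_space A p" and "smooth_fun A f" and "smooth_fun A f'"
  shows "x (\<lambda>q. f q + f' q) = x f + x f'"
proof -
  obtain U h w where U: "(U, h) \<in> A" "p \<in> U"
    and x: "x = (\<lambda>f. if smooth_fun A f
      then frechet_derivative (f \<circ> inv_into U h) (at (h p)) w else 0)"
    using assms(2) unfolding tangent_space_def by blast
  have "((\<lambda>z. (f \<circ> inv_into U h) z + (f' \<circ> inv_into U h) z) has_derivative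
      (\<lambda>w. frechet_derivative (f \<circ> inv_into U h) (at (h p)) w +
        frechet_derivative (f' \<circ> inv_into U h) (at (h p)) w)) (at (h p))"
    using smooth_fun_differentiable[OF assms(3) U] smooth_fun_differentiable[OF assms(4) U]
    unfolding frechet_derivative_works by (rule has_derivative_add)
  from frechet_derivative_at[OF this] show ?thesis
    using assms(3,4) smooth_fun_add[OF assms(1,3,4)]
    by (simp add: x comp_def) metis
qed

lemma tangent_const:
  assumes "x \<in> tangent_space A p"
  shows "x (\<lambda>q. c) = 0"
  using assms by (auto simp: tangent_space_def comp_def)

lemma chart_image_open:
  assumes "smooth_atlas A" and "(V, k) \<in> A" and "open W"
  shows "open (k ` (V \<inter> W))"
proof -
  note open_image = smooth_atlas_chart(2)[OF assms(1,2)]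
    and homeo = smooth_atlas_chart(3)[OF assms(1,2)]
  have "open (k ` V \<inter> inv_into V k -` W)"
    using homeo open_image assms(3)
    by (auto simp: homeomorphism_def intro: continuous_open_preimage)
  moreover have "k ` V \<inter> inv_into V k -` W = k ` (V \<inter> W)"
    using homeo by (force simp: homeomorphism_def)
  ultimately show ?thesis
    by simp
qed

text \<open>
  In a chart around \<open>p\<close> the vector has constant components; multiplying them by a bump function \<open>b\<close>
  supported in the chart and extending by zero gives a global field. It is smooth across the
  boundary of the chart domain because \<open>b\<close> vanishes outside a compact, hence closed,
  set \<open>K\<close> of the manifold, so every point lies in the open set \<open>U\<close> or in the open complement of \<open>K\<close>.
\<close>

lemma extend_tangent_vector:
  fixes A :: "('m::{t2_space, second_countable_topology}, 'e::euclidean_space) chart set"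
  assumes atlas: "smooth_atlas A" and x: "x \<in> tangent_space A p"
  obtains X where "vector_field A X" and "X p = x"
proof -
  obtain U h w where U: "(U, h) \<in> A" "p \<in> U"
    and xw: "x = (\<lambda>f. if smooth_fun A f
      then frechet_derivative (f \<circ> inv_into U h) (at (h p)) w else 0)"
    using x unfolding tangent_space_def by blast
  note open_image = smooth_atlas_chart(2)[OF atlas U(1)]
    and homeo = smooth_atlas_chart(3)[OF atlas U(1)]
  obtain r where r: "r > 0" "cball (h p) r \<subseteq> h ` U"
    using open_image U(2) open_contains_cball by blast
  obtain b :: "'e \<Rightarrow> real" where b: "smooth_on UNIV b" "b (h p) = 1"
    "\<And>z. z \<notin> cball (h p) r \<Longrightarrow> b z = 0"
    using exists_bump_function[OF r(1)] by blast
  define K where "K = inv_into U h ` cball (h p) r"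
  have "compact K"
    using homeo r(2) unfolding K_def homeomorphism_def
    by (meson compact_cball compact_continuous_image continuous_on_subset)
  then have "closed K"
    by (rule compact_imp_closed)
  have b_outside: "b (h q) = 0" if "q \<in> U" "q \<notin> K" for q
  proof (rule b(3))
    show "h q \<notin> cball (h p) r"
      using that homeo unfolding K_def homeomorphism_def by (metis imageI)
  qed
  define G where "G = (\<lambda>f z. b z * frechet_derivative (f \<circ> inv_into U h) (at z) w)"
  define X :: "'m vfield"
    where "X = (\<lambda>q f. if smooth_fun A f \<and> q \<in> U then G f (h q) else 0)"
  have "X p = x"
    using U(2) b(2) by (auto simp: X_def G_def xw)
  moreover have "vector_field A X"
    unfolding vector_field_def
  proof (intro conjI allI impI)
    fix q
    show "X q \<in> tangent_space A q"
    proof (cases "q \<in> U")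
      case True
      have "G f (h q) = frechet_derivative (f \<circ> inv_into U h) (at (h q)) (b (h q) *\<^sub>R w)"
        if "smooth_fun A f" for f
        using linear_frechet_derivative[OF smooth_fun_differentiable[OF that U(1) True]]
        by (simp add: G_def linear_cmul)
      then have "X q = (\<lambda>f. if smooth_fun A f
          then frechet_derivative (f \<circ> inv_into U h) (at (h q)) (b (h q) *\<^sub>R w) else 0)"
        using True by (simp add: X_def fun_eq_iff)
      with True U(1) show ?thesis
        unfolding tangent_space_def by blast
    next
      case False
      obtain V k where V: "(V, k) \<in> A" "q \<in> V"
        using smooth_atlas_cover[OF atlas] by blast
      have "frechet_derivative (f \<circ> inv_into V k) (at (k q)) 0 = 0" if "smooth_fun A f" for f
        using linear_frechet_derivative[OF smooth_fun_differentiable[OF that V]]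
        by (rule linear_0)
      then have "X q = (\<lambda>f. if smooth_fun A f
          then frechet_derivative (f \<circ> inv_into V k) (at (k q)) 0 else 0)"
        using False by (simp add: X_def fun_eq_iff)
      with V show ?thesis
        unfolding tangent_space_def by blast
    qed
  next
    fix f assume f: "smooth_fun A f"
    have G: "Ck_on j (h ` U) (G f)" for j
    proof -
      have "Ck_on j (h ` U) b"
        using b(1) Ck_on_subset unfolding smooth_on_def by blast
      moreover have "Ck_on j (h ` U) (\<lambda>z. frechet_derivative (f \<circ> inv_into U h) (at z) w)"
        using smooth_fun_chart[OF f U(1), of "Suc j"] unfolding Ck_on.simps by blast
      ultimately show ?thesis
        unfolding G_def by (rule Ck_on_mult[OF open_image])
    qed
    show "smooth_fun A (\<lambda>q. X q f)"
    proof (rule smooth_funI, rule Ck_on_local)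
      fix V k j y assume V: "(V, k) \<in> A" and y: "y \<in> k ` V"
      let ?F = "(\<lambda>q. X q f) \<circ> inv_into V k"
      have inv_k: "inv_into V k (k q) = q" if "q \<in> V" for q
        using that smooth_atlas_chart(3)[OF atlas V] unfolding homeomorphism_def by blast
      obtain q where q: "q \<in> V" "y = k q"
        using y by blast
      show "\<exists>T. open T \<and> y \<in> T \<and> Ck_on j T ?F"
      proof (cases "q \<in> U")
        case True
        \<comment> \<open>Near a point of \<open>U\<close> the field is known in the chart \<open>h\<close>; change coordinates to \<open>k\<close>.\<close>
        let ?T = "k ` (V \<inter> U)"
        have T: "open ?T"
          by (rule chart_image_open[OF atlas V smooth_atlas_chart(1)[OF atlas U(1)]])
        have "Ck_on j ?T (h \<circ> inv_into V k)"
          by (rule smooth_atlas_transition[OF atlas V U(1)])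
        moreover have "(h \<circ> inv_into V k) ` ?T \<subseteq> h ` U"
          using inv_k by auto
        ultimately have "Ck_on j ?T (\<lambda>z. G f ((h \<circ> inv_into V k) z))"
          using Ck_on_compose[OF T _ G] by blast
        then have "Ck_on j ?T ?F"
          by (rule Ck_on_cong[OF T, rotated]) (auto simp: X_def f inv_k)
        with T True q show ?thesis
          by blast
      next
        case False
        let ?T = "k ` (V \<inter> - K)"
        have T: "open ?T"
          by (rule chart_image_open[OF atlas V open_Compl[OF \<open>closed K\<close>]])
        have "K \<subseteq> U"
          using r(2) unfolding K_def by (blast intro: inv_into_into)
        have "Ck_on j ?T ?F"
          by (rule Ck_on_cong[OF T _ Ck_on_const[OF T, of _ 0]])
            (auto simp: X_def G_def inv_k b_outside)
        with T False q \<open>K \<subseteq> U\<close> show ?thesis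
          by blast
      qed
    qed
  qed
  ultimately show ?thesis
    using that by blast
qed

section \<open>Linear algebra of almost contact B-metrics\<close>

lemma linear_map_on_add: "linear_map_on V f \<Longrightarrow> x \<in> V \<Longrightarrow> y \<in> V \<Longrightarrow> f (x + y) = f x + f y"
  and linear_map_on_scaleR: "linear_map_on V f \<Longrightarrow> x \<in> V \<Longrightarrow> f (c *\<^sub>R x) = c *\<^sub>R f x"
  unfolding linear_map_on_def by blast+

lemma linear_map_on_zero:
  assumes "linear_map_on V f" and "subspace V"
  shows "f 0 = 0"
  using linear_map_on_scaleR[OF assms(1) subspace_0[OF assms(2)], of 0] by simp

lemma linear_map_on_minus:
  assumes "linear_map_on V f" and "x \<in> V"
  shows "f (- x) = - f x"
  using linear_map_on_scaleR[OF assms, of "-1"] by simp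

lemma linear_map_on_diff:
  assumes "linear_map_on V f" and "subspace V" and "x \<in> V" and "y \<in> V"
  shows "f (x - y) = f x - f y"
  using linear_map_on_add[OF assms(1,3) subspace_neg[OF assms(2,4)]]
    linear_map_on_minus[OF assms(1,4)] by simp

lemma linear_map_on_sum:
  assumes "linear_map_on V f" and "subspace V" and "finite I" and "\<And>i. i \<in> I \<Longrightarrow> x i \<in> V"
  shows "f (\<Sum>i\<in>I. c i *\<^sub>R x i) = (\<Sum>i\<in>I. c i *\<^sub>R f (x i))"
  using assms(3,4)
proof (induction I)
  case empty
  then show ?case
    using linear_map_on_zero[OF assms(1,2)] by simp
next
  case (insert i I)
  then have "(\<Sum>i\<in>I. c i *\<^sub>R x i) \<in> V" "c i *\<^sub>R x i \<in> V"
    using assms(2) by (auto intro: subspace_sum subspace_scale)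
  with insert show ?case
    by (simp add: linear_map_on_add[OF assms(1)] linear_map_on_scaleR[OF assms(1)])
qed

text \<open>
  Pairing a vector with \<open>e\<^sub>j\<close> isolates its \<open>j\<close>-th coordinate, up to a nonzero factor.
\<close>

lemma orthogonal_basis_nondegenerate:
  fixes g :: "'v::real_vector \<Rightarrow> 'v \<Rightarrow> real"
  assumes "subspace V" and lin: "\<And>x. x \<in> V \<Longrightarrow> linear_map_on V (g x)"
    and sym: "\<And>x y. x \<in> V \<Longrightarrow> y \<in> V \<Longrightarrow> g x y = g y x"
    and e: "ordered_basis V m e"
    and ortho: "\<And>i j. i < m \<Longrightarrow> j < m \<Longrightarrow> i \<noteq> j \<Longrightarrow> g (e i) (e j) = 0"
    and unit: "\<And>i. i < m \<Longrightarrow> g (e i) (e i) \<noteq> 0"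
    and "x \<in> V" and x: "\<And>y. y \<in> V \<Longrightarrow> g x y = 0"
  shows "x = 0"
proof -
  have inj: "inj_on e {..<m}" and span: "span (e ` {..<m}) = V"
    using e by (auto simp: ordered_basis_def)
  have eV: "e i \<in> V" if "i < m" for i
    using that span span_base[of "e i" "e ` {..<m}"] by simp
  obtain u where "x = (\<Sum>a\<in>e ` {..<m}. u a *\<^sub>R a)"
    using \<open>x \<in> V\<close> unfolding span[symmetric] span_finite[OF finite_imageI[OF finite_lessThan]]
    by blast
  then have u: "x = (\<Sum>i<m. u (e i) *\<^sub>R e i)"
    unfolding sum.reindex[OF inj] comp_def .
  have "u (e j) = 0" if j: "j < m" for j
  proof -
    have "0 = g (e j) x"
      using x[OF eV[OF j]] sym[OF \<open>x \<in> V\<close> eV[OF j]] by simp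
    also have "\<dots> = (\<Sum>i<m. u (e i) * g (e j) (e i))"
      unfolding u
      using linear_map_on_sum[OF lin[OF eV[OF j]] assms(1) finite_lessThan, of _ e "\<lambda>i. u (e i)"] eV
      by simp
    also have "\<dots> = (\<Sum>i<m. if i = j then u (e j) * g (e j) (e j) else 0)"
      by (rule sum.cong) (use ortho[OF j] in auto)
    also have "\<dots> = u (e j) * g (e j) (e j)"
      using j by simp
    finally show ?thesis
      using unit[OF j] by simp
  qed
  then show ?thesis
    unfolding u by simp
qed

text \<open>
  One tangent space of an almost contact B-metric manifold. It is a subspace \<open>V\<close> of an ambient
  vector space because tangent vectors at a point form a subspace of the space of all functionals.
\<close>

locale almost_contact_B_space =
  fixes V :: "'v::real_vector set" and \<phi> :: "'v \<Rightarrow> 'v" and \<xi> :: 'v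
    and \<eta> :: "'v \<Rightarrow> real" and g :: "'v \<Rightarrow> 'v \<Rightarrow> real"
  assumes V: "subspace V"
    and \<xi>_in [simp]: "\<xi> \<in> V"
    and \<phi>_in [simp]: "x \<in> V \<Longrightarrow> \<phi> x \<in> V"
    and \<phi>_linear: "linear_map_on V \<phi>"
    and \<eta>_linear: "linear_map_on V \<eta>"
    and g_linear: "x \<in> V \<Longrightarrow> linear_map_on V (g x)"
    and g_sym: "x \<in> V \<Longrightarrow> y \<in> V \<Longrightarrow> g x y = g y x"
    and g_nondegenerate: "x \<in> V \<Longrightarrow> (\<And>y. y \<in> V \<Longrightarrow> g x y = 0) \<Longrightarrow> x = 0"
    and \<phi>_\<xi> [simp]: "\<phi> \<xi> = 0"
    and \<eta>_\<xi> [simp]: "\<eta> \<xi> = 1"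
    and \<phi>_\<phi> [simp]: "x \<in> V \<Longrightarrow> \<phi> (\<phi> x) = - x + \<eta> x *\<^sub>R \<xi>"
    and \<eta>_\<phi> [simp]: "x \<in> V \<Longrightarrow> \<eta> (\<phi> x) = 0"
    and g_\<phi>_\<phi>: "x \<in> V \<Longrightarrow> y \<in> V \<Longrightarrow> g (\<phi> x) (\<phi> y) = - g x y + \<eta> x * \<eta> y"
begin

lemma V_closed [simp]:
  "0 \<in> V" "x \<in> V \<Longrightarrow> - x \<in> V" "x \<in> V \<Longrightarrow> c *\<^sub>R x \<in> V"
  "x \<in> V \<Longrightarrow> y \<in> V \<Longrightarrow> x + y \<in> V" "x \<in> V \<Longrightarrow> y \<in> V \<Longrightarrow> x - y \<in> V"
  using V by (auto intro: subspace_0 subspace_neg subspace_scale subspace_add subspace_diff)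

lemma \<phi>_simps [simp]:
  "\<phi> 0 = 0" "x \<in> V \<Longrightarrow> \<phi> (- x) = - \<phi> x" "x \<in> V \<Longrightarrow> \<phi> (c *\<^sub>R x) = c *\<^sub>R \<phi> x"
  "x \<in> V \<Longrightarrow> y \<in> V \<Longrightarrow> \<phi> (x + y) = \<phi> x + \<phi> y" "x \<in> V \<Longrightarrow> y \<in> V \<Longrightarrow> \<phi> (x - y) = \<phi> x - \<phi> y"
  using \<phi>_linear V
  by (simp_all add: linear_map_on_zero linear_map_on_minus linear_map_on_scaleR
      linear_map_on_add linear_map_on_diff)

lemma \<eta>_simps [simp]:
  "\<eta> 0 = 0" "x \<in> V \<Longrightarrow> \<eta> (- x) = - \<eta> x" "x \<in> V \<Longrightarrow> \<eta> (c *\<^sub>R x) = c * \<eta> x"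
  "x \<in> V \<Longrightarrow> y \<in> V \<Longrightarrow> \<eta> (x + y) = \<eta> x + \<eta> y" "x \<in> V \<Longrightarrow> y \<in> V \<Longrightarrow> \<eta> (x - y) = \<eta> x - \<eta> y"
  using linear_map_on_zero[OF \<eta>_linear V] linear_map_on_minus[OF \<eta>_linear]
    linear_map_on_scaleR[OF \<eta>_linear] linear_map_on_add[OF \<eta>_linear] linear_map_on_diff[OF \<eta>_linear V]
  by simp_all

lemma g_right_simps [simp]:
  assumes "z \<in> V"
  shows "g z 0 = 0" "x \<in> V \<Longrightarrow> g z (- x) = - g z x" "x \<in> V \<Longrightarrow> g z (c *\<^sub>R x) = c * g z x"
    "x \<in> V \<Longrightarrow> y \<in> V \<Longrightarrow> g z (x + y) = g z x + g z y"
    "x \<in> V \<Longrightarrow> y \<in> V \<Longrightarrow> g z (x - y) = g z x - g z y"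
  using linear_map_on_zero[OF g_linear[OF assms] V] linear_map_on_minus[OF g_linear[OF assms]]
    linear_map_on_scaleR[OF g_linear[OF assms]] linear_map_on_add[OF g_linear[OF assms]]
    linear_map_on_diff[OF g_linear[OF assms] V]
  by simp_all

lemma g_left_simps [simp]:
  assumes "z \<in> V"
  shows "g 0 z = 0" "x \<in> V \<Longrightarrow> g (- x) z = - g x z" "x \<in> V \<Longrightarrow> g (c *\<^sub>R x) z = c * g x z"
    "x \<in> V \<Longrightarrow> y \<in> V \<Longrightarrow> g (x + y) z = g x z + g y z"
    "x \<in> V \<Longrightarrow> y \<in> V \<Longrightarrow> g (x - y) z = g x z - g y z"
  using assms by (simp_all add: g_sym[of _ z])

lemma g_\<xi> [simp]: "x \<in> V \<Longrightarrow> g x \<xi> = \<eta> x" "x \<in> V \<Longrightarrow> g \<xi> x = \<eta> x"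
  using g_\<phi>_\<phi>[of x \<xi>] by (simp_all add: g_sym[of \<xi> x])

lemma g_\<phi>_left [simp]:
  assumes "x \<in> V" and "y \<in> V"
  shows "g (\<phi> x) y = g x (\<phi> y)"
  using g_\<phi>_\<phi>[of x "\<phi> y"] assms by simp

text \<open>
  The vector \<open>\<phi> h\<close> is not in the span of \<open>h\<close> and \<open>\<xi>\<close>: applying \<open>\<eta>\<close> removes \<open>\<xi>\<close>, and an eigenvector
  equation \<open>\<phi> h = a h\<close> contradicts \<open>\<phi>\<^sup>2 h = - h\<close> for real \<open>a\<close>. Three independent vectors span a space
  of dimension \<open>3\<close>.
\<close>

lemma \<phi>_basis_spans:
  assumes "finite B" and "card B = 3" and "span B = V"
    and h: "h \<in> V" "\<eta> h = 0" "h \<noteq> 0"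
  shows "V \<subseteq> span {\<phi> h, h, \<xi>}"
proof -
  have 1: "h \<notin> span {\<xi>}"
  proof
    assume "h \<in> span {\<xi>}"
    then obtain c where "h = c *\<^sub>R \<xi>"
      by (auto simp: span_singleton)
    then show False
      using h by auto
  qed
  have 2: "\<phi> h \<notin> span {h, \<xi>}"
  proof
    assume "\<phi> h \<in> span {h, \<xi>}"
    then obtain a b where ab: "\<phi> h = a *\<^sub>R h + b *\<^sub>R \<xi>"
      by (auto simp: span_insert span_singleton algebra_simps)
    have "\<eta> (\<phi> h) = b"
      unfolding ab using h by simp
    then have "b = 0"
      using h by simp
    have "- h = \<phi> (\<phi> h)"
      using h by simp
    also have "\<dots> = (a * a) *\<^sub>R h"
      using ab \<open>b = 0\<close> h by simp
    finally have eq: "- h = (a * a) *\<^sub>R h" .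
    have "(a * a + 1) *\<^sub>R h = 0"
      by (simp add: scaleR_add_left flip: eq)
    moreover have "a * a + 1 > 0"
      by (rule add_nonneg_pos) auto
    ultimately show False
      using h(3) by auto
  qed
  have "\<xi> \<noteq> 0"
    using \<eta>_\<xi> \<eta>_simps(1) zero_neq_one by metis
  then have indep: "independent {\<phi> h, h, \<xi>}"
    using 1 2 independent_empty by (intro independent_insertI) auto
  have "h \<noteq> \<xi>" "\<phi> h \<noteq> h" "\<phi> h \<noteq> \<xi>"
    using 1 2 by (auto simp: span_base)
  then have card: "card {\<phi> h, h, \<xi>} = 3"
    by simp
  show ?thesis
  proof (rule subsetI, rule ccontr)
    fix y assume y: "y \<in> V" "y \<notin> span {\<phi> h, h, \<xi>}"
    have "independent (insert y {\<phi> h, h, \<xi>})"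
      by (rule independent_insertI[OF y(2) indep])
    moreover have "insert y {\<phi> h, h, \<xi>} \<subseteq> span B"
      unfolding assms(3) using y(1) h(1) by simp
    ultimately have "card (insert y {\<phi> h, h, \<xi>}) \<le> card B"
      using independent_span_bound[OF assms(1)] by blast
    moreover have "y \<notin> {\<phi> h, h, \<xi>}"
      using y(2) span_base[of y "{\<phi> h, h, \<xi>}"] by argo
    then have "card (insert y {\<phi> h, h, \<xi>}) = 4"
      using card_insert_disjoint[of "{\<phi> h, h, \<xi>}" y] card by simp
    ultimately show False
      unfolding assms(2) by simp
  qed
qed

lemma orthogonal_to_span:
  assumes "u \<in> V" and "S \<subseteq> V" and "\<And>w. w \<in> S \<Longrightarrow> g u w = 0" and "w \<in> span S"
  shows "g u w = 0"
proof -
  have "subspace {w \<in> V. g u w = 0}"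
    using assms(1) by (auto simp: subspace_def)
  then have "span S \<subseteq> {w \<in> V. g u w = 0}"
    using assms by (intro span_minimal) auto
  with assms(4) show ?thesis
    by blast
qed

lemma orthogonal_to_\<phi>_basis:
  assumes "finite B" and "card B = 3" and "span B = V"
    and z: "z \<in> V" "z \<noteq> \<eta> z *\<^sub>R \<xi>"
    and t: "t \<in> V" "g t z = 0" "g t (\<phi> z) = 0" "g t \<xi> = 0"
  shows "t = 0"
proof -
  define h where "h = z - \<eta> z *\<^sub>R \<xi>"
  have h: "h \<in> V" "\<eta> h = 0" "h \<noteq> 0"
    using z by (simp_all add: h_def)
  have orth: "g t y = 0" if "y \<in> {\<phi> h, h, \<xi>}" for y
    using that z t by (auto simp: h_def)
  have sub: "{\<phi> h, h, \<xi>} \<subseteq> V"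
    using h(1) by simp
  show ?thesis
  proof (rule g_nondegenerate[OF t(1)])
    show "g t y = 0" if "y \<in> V" for y
      by (rule orthogonal_to_span[OF t(1) sub orth subsetD[OF \<phi>_basis_spans[OF assms(1-3) h] that]])
  qed
qed

section \<open>The curvature tensor forced by the Sasaki-like condition\<close>

text \<open>
  The Sasaki-like condition says that this is the value of \<open>(\<nabla>\<^sub>x \<phi>) y\<close>.
\<close>

definition nabla_\<phi> :: "'v \<Rightarrow> 'v \<Rightarrow> 'v" where
  "nabla_\<phi> x y = - (g x y *\<^sub>R \<xi>) - \<eta> y *\<^sub>R x + (2 * \<eta> x * \<eta> y) *\<^sub>R \<xi>"

text \<open>
  Grouped by \<open>x\<close>, \<open>y\<close> and \<open>\<xi>\<close>, this is the curvature tensor of constant sectional curvature \<open>-1\<close> plus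
  twice the Kulkarni-Nomizu product of \<open>g\<close> and \<open>\<eta> \<otimes> \<eta>\<close>. On the kernel of \<open>\<eta>\<close> the prescribed commutator
  of \<open>R(x, \<phi> x)\<close> with \<open>\<phi>\<close> forces the coefficient \<open>-1\<close>, and then \<open>R(x, \<xi>) \<xi> = x\<close> forces the
  coefficient \<open>2\<close>.
\<close>

definition model_curvature :: "'v \<Rightarrow> 'v \<Rightarrow> 'v \<Rightarrow> 'v" where
  "model_curvature x y z =
     (2 * \<eta> y * \<eta> z - g y z) *\<^sub>R x - (2 * \<eta> x * \<eta> z - g x z) *\<^sub>R y
     + (2 * (g y z * \<eta> x - g x z * \<eta> y)) *\<^sub>R \<xi>"

text \<open>
  The second covariant derivative \<open>(\<nabla>\<^sup>2\<^sub>x\<^sub>,\<^sub>y \<phi>) z\<close>, which results from differentiating the tensor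
  \<^term>\<open>nabla_\<phi> y z\<close> in direction \<open>x\<close> with \<open>\<nabla>\<^sub>x \<xi> = - \<phi> x\<close> and \<open>(\<nabla>\<^sub>x \<eta>) z = - g(x, \<phi> z)\<close>.
\<close>

definition nabla2_\<phi> :: "'v \<Rightarrow> 'v \<Rightarrow> 'v \<Rightarrow> 'v" where
  "nabla2_\<phi> x y z =
     (g y z - 2 * \<eta> y * \<eta> z) *\<^sub>R \<phi> x + g x (\<phi> z) *\<^sub>R y
     - (2 * (\<eta> z * g x (\<phi> y) + \<eta> y * g x (\<phi> z))) *\<^sub>R \<xi>"

lemma nabla_\<phi>_\<xi>: "x \<in> V \<Longrightarrow> nabla_\<phi> x \<xi> = \<eta> x *\<^sub>R \<xi> - x"
  by (simp add: nabla_\<phi>_def flip: scaleR_diff_left)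

lemma nabla_\<phi>_diff_left:
  "x \<in> V \<Longrightarrow> y \<in> V \<Longrightarrow> z \<in> V \<Longrightarrow> nabla_\<phi> (x - y) z = nabla_\<phi> x z - nabla_\<phi> y z"
  by (simp add: nabla_\<phi>_def algebra_simps)

lemma nabla_\<phi>_swap:
  "x \<in> V \<Longrightarrow> y \<in> V \<Longrightarrow> nabla_\<phi> x y - nabla_\<phi> y x = \<eta> x *\<^sub>R y - \<eta> y *\<^sub>R x"
  by (simp add: nabla_\<phi>_def g_sym[of y x] mult_ac)

lemma model_curvature_in [simp]:
  "x \<in> V \<Longrightarrow> y \<in> V \<Longrightarrow> z \<in> V \<Longrightarrow> model_curvature x y z \<in> V"
  by (simp add: model_curvature_def)

lemma model_curvature_\<xi>:
  "x \<in> V \<Longrightarrow> y \<in> V \<Longrightarrow> model_curvature x y \<xi> = \<eta> y *\<^sub>R x - \<eta> x *\<^sub>R y"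
  by (simp add: model_curvature_def algebra_simps)

lemma model_curvature_\<phi>:
  "x \<in> V \<Longrightarrow> y \<in> V \<Longrightarrow> z \<in> V \<Longrightarrow>
    model_curvature x y (\<phi> z) = \<phi> (model_curvature x y z) + (nabla2_\<phi> x y z - nabla2_\<phi> y x z)"
  by (simp add: model_curvature_def nabla2_\<phi>_def g_sym[of y "\<phi> x"] algebra_simps)

lemma model_curvature_skew:
  "x \<in> V \<Longrightarrow> y \<in> V \<Longrightarrow> z \<in> V \<Longrightarrow> w \<in> V \<Longrightarrow>
    g (model_curvature x y z) w + g z (model_curvature x y w) = 0"
  by (simp add: model_curvature_def g_sym[of z x] g_sym[of z y] algebra_simps)

text \<open>
  Here \<open>F\<close> stands for vector fields, \<open>val\<close> for evaluation at a point and \<open>R Z\<close> for the value of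
  \<open>R(X, Y) Z\<close> at that point. A priori this value depends on the whole field \<open>Z\<close>; that it depends on
  \<open>Z\<close> only through its value at the point is part of the conclusion. Skewness makes \<open>T Z\<close> orthogonal to \<open>Z\<close>, \<open>\<phi> Z\<close> and \<open>\<xi>\<close>, which leaves only
  fields \<open>Z\<close> that are multiples of \<open>\<xi>\<close> at the point; those are handled by moving \<open>T\<close> to the other
  argument of \<open>g\<close>.
\<close>

lemma model_curvature_eqI:
  assumes B: "finite B" "card B = 3" "span B = V"
    and F_in: "\<And>X. X \<in> F \<Longrightarrow> val X \<in> V" "\<And>X. X \<in> F \<Longrightarrow> R X \<in> V"
    and surj: "\<And>z. z \<in> V \<Longrightarrow> \<exists>X\<in>F. val X = z"
    and \<xi>': "\<xi>' \<in> F" "val \<xi>' = \<xi>" "R \<xi>' = \<eta> y *\<^sub>R x - \<eta> x *\<^sub>R y"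
    and \<phi>': "\<And>X. X \<in> F \<Longrightarrow> \<phi>' X \<in> F" "\<And>X. X \<in> F \<Longrightarrow> val (\<phi>' X) = \<phi> (val X)"
      "\<And>X. X \<in> F \<Longrightarrow> R (\<phi>' X) = \<phi> (R X) + (nabla2_\<phi> x y (val X) - nabla2_\<phi> y x (val X))"
    and skew: "\<And>X Y. X \<in> F \<Longrightarrow> Y \<in> F \<Longrightarrow> g (R X) (val Y) + g (val X) (R Y) = 0"
    and xy: "x \<in> V" "y \<in> V" and X: "X \<in> F"
  shows "R X = model_curvature x y (val X)"
proof -
  define T where "T = (\<lambda>X. R X - model_curvature x y (val X))"
  have T_in: "T X \<in> V" if "X \<in> F" for X
    using that F_in xy by (simp add: T_def)
  have T_\<xi>: "T \<xi>' = 0"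
    using xy \<xi>' by (simp add: T_def model_curvature_\<xi>)
  have T_\<phi>: "T (\<phi>' X) = \<phi> (T X)" if "X \<in> F" for X
    using that xy F_in \<phi>' by (simp add: T_def model_curvature_\<phi>)
  have T_skew: "g (T X) (val Y) = - g (val X) (T Y)" if "X \<in> F" "Y \<in> F" for X Y
    using that xy F_in skew[OF that] model_curvature_skew[OF xy F_in(1)[OF that(1)] F_in(1)[OF that(2)]]
    by (simp add: T_def)
  have off_axis: "T X = 0" if "X \<in> F" "val X \<noteq> \<eta> (val X) *\<^sub>R \<xi>" for X
  proof (rule orthogonal_to_\<phi>_basis[OF B F_in(1)[OF that(1)] that(2) T_in[OF that(1)]])
    show "g (T X) (val X) = 0"
      using T_skew[OF that(1,1)] T_in that F_in by (simp add: g_sym[of "val X"])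
    show "g (T X) \<xi> = 0"
      using T_skew[OF that(1) \<xi>'(1)] T_\<xi> F_in that \<xi>' by simp
    have "g (T X) (\<phi> (val X)) = - g (val X) (T (\<phi>' X))"
      using T_skew[OF that(1) \<phi>'(1)[OF that(1)]] \<phi>' that by simp
    also have "\<dots> = - g (T X) (\<phi> (val X))"
      using T_\<phi> T_in F_in that by (simp add: g_sym[of "val X"])
    finally show "g (T X) (\<phi> (val X)) = 0"
      by simp
  qed
  have "T X = 0"
  proof (cases "val X = \<eta> (val X) *\<^sub>R \<xi>")
    case True
    show ?thesis
    proof (rule g_nondegenerate[OF T_in[OF X]])
      fix w assume "w \<in> V"
      then obtain W where W: "W \<in> F" "val W = w"
        using surj by blast
      show "g (T X) w = 0"
      proof (cases "w = \<eta> w *\<^sub>R \<xi>")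
        case True
        have "g (T X) \<xi> = 0"
          using T_skew[OF X \<xi>'(1)] T_\<xi> F_in X \<xi>' by simp
        then have "g (T X) (\<eta> w *\<^sub>R \<xi>) = 0"
          using T_in[OF X] by simp
        with True show ?thesis
          by simp
      next
        case False
        then show ?thesis
          using off_axis[of W] T_skew[OF X W(1)] W F_in(1)[OF X] by simp
      qed
    qed
  qed (rule off_axis[OF X])
  then show ?thesis
    by (simp add: T_def)
qed

text \<open>
  If the Gram determinant vanishes, then \<open>g(b, b) a - g(a, b) b\<close> is orthogonal to the whole plane.
\<close>

lemma gram_det_nonzero:
  assumes a: "a \<in> V" and b: "b \<in> V"
    and indep: "independent {a, b}" "a \<noteq> b"
    and nondeg: "\<And>u. u \<in> span {a, b} \<Longrightarrow> (\<And>w. w \<in> span {a, b} \<Longrightarrow> g u w = 0) \<Longrightarrow> u = 0"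
  shows "g a a * g b b - (g a b)\<^sup>2 \<noteq> 0"
proof
  assume det: "g a a * g b b - (g a b)\<^sup>2 = 0"
  have "a \<notin> span {b}" "b \<noteq> 0"
    using indep by (auto simp: independent_insert)
  let ?u = "g b b *\<^sub>R a - g a b *\<^sub>R b"
  have "?u = 0"
  proof (rule nondeg)
    show "?u \<in> span {a, b}"
      by (intro span_diff span_scale span_base) auto
    show "g ?u w = 0" if "w \<in> span {a, b}" for w
    proof (rule orthogonal_to_span[OF _ _ _ that])
      show "g ?u w = 0" if "w \<in> {a, b}" for w
        using that a b det by (auto simp: g_sym[of b a] power2_eq_square algebra_simps)
    qed (use a b in auto)
  qed
  then have eq: "g b b *\<^sub>R a = g a b *\<^sub>R b"
    by simp
  have bb: "g b b = 0"
  proof (rule ccontr)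
    assume "g b b \<noteq> 0"
    then have "a = (g a b / g b b) *\<^sub>R b"
      using eq by (metis scaleR_scaleR divide_inverse mult.commute left_inverse scaleR_one)
    then show False
      using \<open>a \<notin> span {b}\<close> span_scale[OF span_base, of b "{b}"] by (metis insertI1)
  qed
  with eq \<open>b \<noteq> 0\<close> have ab: "g a b = 0"
    by simp
  have "b = 0"
  proof (rule nondeg)
    show "b \<in> span {a, b}"
      by (intro span_base) simp
    show "g b w = 0" if "w \<in> span {a, b}" for w
      by (rule orthogonal_to_span[OF _ _ _ that]) (use a b bb ab in \<open>auto simp: g_sym[of b a]\<close>)
  qed
  with \<open>b \<noteq> 0\<close> show False
    by simp
qed

lemma model_curvature_section:
  assumes "a \<in> V" and "b \<in> V"
  shows "g (model_curvature a b b) a =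
    2 * (g a a * (\<eta> b)\<^sup>2 - 2 * \<eta> a * \<eta> b * g a b + g b b * (\<eta> a)\<^sup>2) - (g a a * g b b - (g a b)\<^sup>2)"
  using assms
  by (simp add: model_curvature_def g_sym[of b a] power2_eq_square algebra_simps)

lemma model_curvature_horizontal:
  assumes "a \<in> V" and "b \<in> V" and "\<eta> a = 0" and "\<eta> b = 0"
  shows "g (model_curvature a b b) a = - (g a a * g b b - (g a b)\<^sup>2)"
  using assms by (simp add: model_curvature_section)

text \<open>
  With \<open>\<xi> = c a + d b\<close> the numbers \<open>\<eta>(a)\<close> and \<open>\<eta>(b)\<close> are the image of \<open>(c, d)\<close> under the Gram matrix
  \<open>G\<close>. The quadratic form of the adjugate of \<open>G\<close> at that image is \<open>det G\<close> times the quadratic form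
  of \<open>G\<close> at \<open>(c, d)\<close>, which is \<open>g(\<xi>, \<xi>) = 1\<close>.
\<close>

lemma model_curvature_vertical:
  assumes "a \<in> V" and "b \<in> V" and "\<xi> \<in> span {a, b}"
  shows "g (model_curvature a b b) a = g a a * g b b - (g a b)\<^sup>2"
proof -
  obtain c d where \<xi>: "\<xi> = c *\<^sub>R a + d *\<^sub>R b"
    using assms(3) by (auto simp: span_insert span_singleton algebra_simps)
  have "\<eta> a = g a (c *\<^sub>R a + d *\<^sub>R b)" "\<eta> b = g b (c *\<^sub>R a + d *\<^sub>R b)"
    using assms by (simp_all flip: \<xi>)
  then have a: "\<eta> a = c * g a a + d * g a b" and b: "\<eta> b = c * g a b + d * g b b"
    using assms(1,2) by (simp_all add: g_sym[of b a])
  have "\<eta> (c *\<^sub>R a + d *\<^sub>R b) = 1"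
    by (simp flip: \<xi>)
  then have 1: "c * \<eta> a + d * \<eta> b = 1"
    using assms(1,2) by simp
  have "g a a * (\<eta> b)\<^sup>2 - 2 * \<eta> a * \<eta> b * g a b + g b b * (\<eta> a)\<^sup>2 =
      (g a a * g b b - (g a b)\<^sup>2) * (c * \<eta> a + d * \<eta> b)"
    unfolding a b by algebra
  with 1 show ?thesis
    using assms(1,2) by (simp add: model_curvature_section)
qed

end

section \<open>Curvature identities of Sasaki-like manifolds\<close>

locale sasaki_like_manifold =
  fixes A :: "('m::{t2_space, second_countable_topology}, 'e::euclidean_space) chart set"
    and \<phi> :: "'m \<Rightarrow> 'm tangent \<Rightarrow> 'm tangent"
    and \<xi> :: "'m vfield"
    and \<eta> :: "'m \<Rightarrow> 'm tangent \<Rightarrow> real"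
    and g :: "'m metric"
    and D :: "'m connection"
  assumes B_metric: "almost_contact_B_metric A \<phi> \<xi> \<eta> g"
    and levi_civita: "levi_civita_connection A g D"
    and sasaki: "sasaki_like A \<phi> \<xi> \<eta> g D"
begin

lemma atlas: "smooth_atlas A"
  using B_metric unfolding almost_contact_B_metric_def by blast

lemma metric: "\<exists>n. DIM('e) = 2 * n + 1 \<and> pseudo_riemannian_metric A (n + 1) n g"
  using B_metric unfolding almost_contact_B_metric_def by blast

lemma tangent_basis:
  obtains e where "ordered_basis (tangent_space A p) DIM('e) e"
    and "\<And>i j. i < DIM('e) \<Longrightarrow> j < DIM('e) \<Longrightarrow> i \<noteq> j \<Longrightarrow> g p (e i) (e j) = 0"
    and "\<And>i. i < DIM('e) \<Longrightarrow> g p (e i) (e i) \<noteq> 0"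
proof -
  obtain n where n: "DIM('e) = n + 1 + n" and "pseudo_riemannian_metric A (n + 1) n g"
    using metric by (auto simp: mult_2)
  then obtain e where e: "ordered_basis (tangent_space A p) (n + 1 + n) e"
    "\<forall>i<n + 1 + n. \<forall>j<n + 1 + n.
       g p (e i) (e j) = (if i \<noteq> j then 0 else if i < n + 1 then 1 else - 1)"
    unfolding pseudo_riemannian_metric_def by blast
  show ?thesis
    by (rule that[of e]) (use e in \<open>simp_all add: n\<close>)
qed

lemma tangent_space_subspace: "subspace (tangent_space A p)"
proof -
  obtain e where "ordered_basis (tangent_space A p) DIM('e) e"
    by (rule tangent_basis[of p])
  then have "span (e ` {..<DIM('e)}) = tangent_space A p"
    unfolding ordered_basis_def by blast
  then show ?thesis
    using subspace_span[of "e ` {..<DIM('e)}"] by simp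
qed

lemma metric_linear: "x \<in> tangent_space A p \<Longrightarrow> linear_map_on (tangent_space A p) (g p x)"
  and metric_sym: "x \<in> tangent_space A p \<Longrightarrow> y \<in> tangent_space A p \<Longrightarrow> g p x y = g p y x"
  and smooth_metric: "vector_field A X \<Longrightarrow> vector_field A Y \<Longrightarrow> smooth_fun A (\<lambda>q. g q (X q) (Y q))"
  using metric unfolding pseudo_riemannian_metric_def by blast+

lemma metric_nondegenerate:
  assumes "x \<in> tangent_space A p" and "\<And>y. y \<in> tangent_space A p \<Longrightarrow> g p x y = 0"
  shows "x = 0"
proof -
  obtain e where e: "ordered_basis (tangent_space A p) DIM('e) e"
    "\<And>i j. i < DIM('e) \<Longrightarrow> j < DIM('e) \<Longrightarrow> i \<noteq> j \<Longrightarrow> g p (e i) (e j) = 0"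
    "\<And>i. i < DIM('e) \<Longrightarrow> g p (e i) (e i) \<noteq> 0"
    by (rule tangent_basis[of p], rule that) simp_all
  show ?thesis
    by (rule orthogonal_basis_nondegenerate[where V = "tangent_space A p" and g = "g p",
          OF tangent_space_subspace _ _ e])
      (blast intro: metric_linear metric_sym assms)+
qed

lemma endomorphism: "tangent_endomorphism A \<phi>"
  using B_metric unfolding almost_contact_B_metric_def by blast

lemma form: "one_form A \<eta>"
  using B_metric unfolding almost_contact_B_metric_def by blast

lemma field_\<xi>: "vector_field A \<xi>"
  using B_metric unfolding almost_contact_B_metric_def by blast

lemma field_tangent: "vector_field A X \<Longrightarrow> X p \<in> tangent_space A p"
  unfolding vector_field_def by blast

sublocale pt: almost_contact_B_space "tangent_space A p" "\<phi> p" "\<xi> p" "\<eta> p" "g p" for p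
proof
  show "subspace (tangent_space A p)"
    by (rule tangent_space_subspace)
  show "\<xi> p \<in> tangent_space A p"
    by (rule field_tangent[OF field_\<xi>])
  show "\<phi> p x \<in> tangent_space A p" if "x \<in> tangent_space A p" for x
    using that endomorphism unfolding tangent_endomorphism_def by blast
  show "linear_map_on (tangent_space A p) (\<phi> p)"
    using endomorphism unfolding tangent_endomorphism_def by blast
  show "linear_map_on (tangent_space A p) (\<eta> p)"
    using form unfolding one_form_def by blast
  show "linear_map_on (tangent_space A p) (g p x)" if "x \<in> tangent_space A p" for x
    by (rule metric_linear[OF that])
  show "g p x y = g p y x" if "x \<in> tangent_space A p" "y \<in> tangent_space A p" for x y
    by (rule metric_sym[OF that])
  show "x = 0" if "x \<in> tangent_space A p" "\<And>y. y \<in> tangent_space A p \<Longrightarrow> g p x y = 0" for x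
    by (rule metric_nondegenerate[OF that])
  show "\<phi> p (\<xi> p) = 0" "\<eta> p (\<xi> p) = 1"
    using B_metric unfolding almost_contact_B_metric_def by blast+
  show "\<phi> p (\<phi> p x) = - x + \<eta> p x *\<^sub>R \<xi> p" "\<eta> p (\<phi> p x) = 0"
    if "x \<in> tangent_space A p" for x
    using B_metric that unfolding almost_contact_B_metric_def by blast+
  show "g p (\<phi> p x) (\<phi> p y) = - g p x y + \<eta> p x * \<eta> p y"
    if "x \<in> tangent_space A p" "y \<in> tangent_space A p" for x y
    using B_metric that unfolding almost_contact_B_metric_def by blast
qed

abbreviation nabla_\<phi>_at :: "'m \<Rightarrow> 'm tangent \<Rightarrow> 'm tangent \<Rightarrow> 'm tangent" where
  "nabla_\<phi>_at p \<equiv> almost_contact_B_space.nabla_\<phi> (\<xi> p) (\<eta> p) (g p)"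

abbreviation model_curvature_at ::
  "'m \<Rightarrow> 'm tangent \<Rightarrow> 'm tangent \<Rightarrow> 'm tangent \<Rightarrow> 'm tangent" where
  "model_curvature_at p \<equiv> almost_contact_B_space.model_curvature (\<xi> p) (\<eta> p) (g p)"

abbreviation nabla2_\<phi>_at ::
  "'m \<Rightarrow> 'm tangent \<Rightarrow> 'm tangent \<Rightarrow> 'm tangent \<Rightarrow> 'm tangent" where
  "nabla2_\<phi>_at p \<equiv> almost_contact_B_space.nabla2_\<phi> (\<phi> p) (\<xi> p) (\<eta> p) (g p)"

lemma field_add:
  assumes "vector_field A X" and "vector_field A Y"
  shows "vector_field A (\<lambda>q. X q + Y q)"
  unfolding vector_field_def
proof (intro conjI allI impI)
  show "X p + Y p \<in> tangent_space A p" for p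
    using assms by (simp add: field_tangent)
  show "smooth_fun A (\<lambda>p. (X p + Y p) f)" if "smooth_fun A f" for f
    using assms that smooth_fun_add[OF atlas] unfolding vector_field_def plus_fun_def by blast
qed

lemma field_scaleR:
  assumes "smooth_fun A f" and "vector_field A X"
  shows "vector_field A (\<lambda>q. f q *\<^sub>R X q)"
  unfolding vector_field_def
proof (intro conjI allI impI)
  show "f p *\<^sub>R X p \<in> tangent_space A p" for p
    using assms by (simp add: field_tangent)
  show "smooth_fun A (\<lambda>p. (f p *\<^sub>R X p) f')" if "smooth_fun A f'" for f'
    using assms that smooth_fun_mult[OF atlas]
    unfolding vector_field_def scaleR_fun_def real_scaleR_def by blast
qed

lemma field_const_scaleR: "vector_field A X \<Longrightarrow> vector_field A (\<lambda>q. c *\<^sub>R X q)"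
  by (rule field_scaleR[OF smooth_fun_const[OF atlas]])

lemma field_\<phi>: "vector_field A X \<Longrightarrow> vector_field A (\<lambda>q. \<phi> q (X q))"
  using endomorphism unfolding tangent_endomorphism_def by blast

lemma smooth_\<eta>: "vector_field A X \<Longrightarrow> smooth_fun A (\<lambda>q. \<eta> q (X q))"
  using form unfolding one_form_def by blast

lemma connection: "affine_connection A D"
  using levi_civita unfolding levi_civita_connection_def by blast

lemma field_D: "vector_field A X \<Longrightarrow> vector_field A Y \<Longrightarrow> vector_field A (D X Y)"
  using connection unfolding affine_connection_def by blast

lemma D_add:
  assumes "vector_field A X" "vector_field A Y" "vector_field A Z"
  shows "D X (\<lambda>q. Y q + Z q) = (\<lambda>q. D X Y q + D X Z q)"
  using connection assms unfolding affine_connection_def plus_fun_def by blast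

lemma D_scaleR:
  assumes "smooth_fun A f" "vector_field A X" "vector_field A Y"
  shows "D X (\<lambda>q. f q *\<^sub>R Y q) = (\<lambda>q. X q f *\<^sub>R Y q + f q *\<^sub>R D X Y q)"
  using connection assms unfolding affine_connection_def by blast

lemma D_const_scaleR:
  assumes "vector_field A X" "vector_field A Y"
  shows "D X (\<lambda>q. c *\<^sub>R Y q) = (\<lambda>q. c *\<^sub>R D X Y q)"
proof -
  have "X q (\<lambda>_. c) = 0" for q
    by (rule tangent_const[OF field_tangent[OF assms(1)]])
  then show ?thesis
    using D_scaleR[OF smooth_fun_const[OF atlas] assms, of c] by simp
qed

lemma torsion_free:
  assumes "vector_field A X" "vector_field A Y"
  shows "lie_bracket X Y = (\<lambda>q. D X Y q - D Y X q)"
proof -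
  have "D X Y - D Y X = lie_bracket X Y"
    using levi_civita assms unfolding levi_civita_connection_def by blast
  from this[symmetric] show ?thesis
    by (simp add: fun_eq_iff)
qed

lemma field_lie_bracket:
  assumes "vector_field A X" "vector_field A Y"
  shows "vector_field A (lie_bracket X Y)"
proof -
  have "vector_field A (\<lambda>q. D X Y q + (- 1) *\<^sub>R D Y X q)"
    by (rule field_add[OF field_D[OF assms] field_const_scaleR[OF field_D[OF assms(2,1)]]])
  then show ?thesis
    by (simp add: torsion_free[OF assms])
qed

lemma metric_compatible:
  assumes "vector_field A X" "vector_field A Y" "vector_field A Z"
  shows "X p (\<lambda>q. g q (Y q) (Z q)) = g p (D X Y p) (Z p) + g p (Y p) (D X Z p)"
  using levi_civita assms unfolding levi_civita_connection_def by blast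

lemma D_\<phi>:
  assumes "vector_field A X" "vector_field A Y"
  shows "D X (\<lambda>q. \<phi> q (Y q)) = (\<lambda>p. \<phi> p (D X Y p) + nabla_\<phi>_at p (X p) (Y p))"
proof
  fix p
  have "D X (\<lambda>q. \<phi> q (Y q)) p - \<phi> p (D X Y p) = nabla_\<phi>_at p (X p) (Y p)"
    using sasaki assms unfolding sasaki_like_def pt.nabla_\<phi>_def by blast
  then show "D X (\<lambda>q. \<phi> q (Y q)) p = \<phi> p (D X Y p) + nabla_\<phi>_at p (X p) (Y p)"
    by (simp add: algebra_simps)
qed

text \<open>
  Since \<open>\<phi> \<xi> = 0\<close>, the condition for \<open>y = \<xi>\<close> determines \<open>\<phi> (\<nabla>\<^sub>x \<xi>)\<close>, hence \<open>\<nabla>\<^sub>x \<xi>\<close> up to a multiple of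
  \<open>\<xi>\<close>. That multiple is \<open>0\<close> because \<open>g(\<xi>, \<xi>)\<close> is constant.
\<close>

lemma D_\<xi>:
  assumes X: "vector_field A X"
  shows "D X \<xi> = (\<lambda>p. - \<phi> p (X p))"
proof
  fix p
  note tangent = field_tangent[OF X] field_tangent[OF field_D[OF X field_\<xi>]]
  have "D X (\<lambda>q. 0 *\<^sub>R \<xi> q) = (\<lambda>q. 0 *\<^sub>R D X \<xi> q)"
    by (rule D_const_scaleR[OF X field_\<xi>])
  then have "\<phi> p (D X \<xi> p) + nabla_\<phi>_at p (X p) (\<xi> p) = 0"
    using D_\<phi>[OF X field_\<xi>] by (simp add: fun_eq_iff)
  then have "\<phi> p (D X \<xi> p) = X p - \<eta> p (X p) *\<^sub>R \<xi> p"
    using tangent by (simp add: pt.nabla_\<phi>_\<xi> algebra_simps)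
  from arg_cong[OF this, of "\<phi> p"] have "D X \<xi> p = - \<phi> p (X p) + \<eta> p (D X \<xi> p) *\<^sub>R \<xi> p"
    using tangent by (simp add: algebra_simps)
  moreover have "\<eta> p (D X \<xi> p) = 0"
    using metric_compatible[OF X field_\<xi> field_\<xi>, of p] tangent
      tangent_const[OF tangent(1)] by simp
  ultimately show "D X \<xi> p = - \<phi> p (X p)"
    by simp
qed

lemma derivative_\<eta>:
  assumes X: "vector_field A X" and Y: "vector_field A Y"
  shows "X p (\<lambda>q. \<eta> q (Y q)) = \<eta> p (D X Y p) - g p (Y p) (\<phi> p (X p))"
  using metric_compatible[OF X Y field_\<xi>, of p] field_tangent[OF X] field_tangent[OF Y]
    field_tangent[OF field_D[OF X Y]]
  by (simp add: D_\<xi>[OF X])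

text \<open>
  As \<open>\<nabla>\<^sub>X \<xi> = - \<phi> X\<close>, the curvature on \<open>\<xi>\<close> is the antisymmetrised derivative of \<open>- \<phi>\<close>; the terms with
  \<open>\<phi> (\<nabla>\<^sub>X Y)\<close> cancel because the connection has no torsion.
\<close>

lemma curvature_\<xi>:
  assumes X: "vector_field A X" and Y: "vector_field A Y"
  shows "curvature_field D X Y \<xi> p = \<eta> p (Y p) *\<^sub>R X p - \<eta> p (X p) *\<^sub>R Y p"
proof -
  have "D X (\<lambda>q. - \<phi> q (Y q)) p = - (\<phi> p (D X Y p) + nabla_\<phi>_at p (X p) (Y p))"
    if "vector_field A X" "vector_field A Y" for X Y
    using D_const_scaleR[OF that(1) field_\<phi>[OF that(2)], of "-1"] by (simp add: D_\<phi>[OF that])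
  moreover have "lie_bracket X Y p = D X Y p - D Y X p"
    by (simp add: torsion_free[OF X Y])
  then have "D (lie_bracket X Y) \<xi> p = - \<phi> p (D X Y p - D Y X p)"
    by (simp only: D_\<xi>[OF field_lie_bracket[OF X Y]])
  ultimately have "curvature_field D X Y \<xi> p =
      - (nabla_\<phi>_at p (X p) (Y p) - nabla_\<phi>_at p (Y p) (X p))"
    using X Y by (simp add: curvature_field_def D_\<xi> field_tangent field_D)
  then show ?thesis
    using X Y by (simp add: pt.nabla_\<phi>_swap field_tangent)
qed

text \<open>
  A sum of smooth multiples of fields, to which the Leibniz rule of the connection applies term by
  term.
\<close>

lemma nabla_\<phi>_decompose:
  "nabla_\<phi>_at q y z = (- 1) *\<^sub>R (g q y z *\<^sub>R \<xi> q) +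
     ((- 1) *\<^sub>R (\<eta> q z *\<^sub>R y) + 2 *\<^sub>R (\<eta> q y *\<^sub>R (\<eta> q z *\<^sub>R \<xi> q)))"
  by (simp add: pt.nabla_\<phi>_def mult.assoc)

lemma nabla_\<phi>_summands:
  assumes Y: "vector_field A Y" and Z: "vector_field A Z"
  shows "vector_field A (\<lambda>q. g q (Y q) (Z q) *\<^sub>R \<xi> q)" "vector_field A (\<lambda>q. \<eta> q (Z q) *\<^sub>R Y q)"
    "vector_field A (\<lambda>q. \<eta> q (Y q) *\<^sub>R (\<eta> q (Z q) *\<^sub>R \<xi> q))"
proof -
  show "vector_field A (\<lambda>q. g q (Y q) (Z q) *\<^sub>R \<xi> q)"
    by (rule field_scaleR[OF smooth_metric[OF Y Z] field_\<xi>])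
  show "vector_field A (\<lambda>q. \<eta> q (Z q) *\<^sub>R Y q)"
    by (rule field_scaleR[OF smooth_\<eta>[OF Z] Y])
  show "vector_field A (\<lambda>q. \<eta> q (Y q) *\<^sub>R (\<eta> q (Z q) *\<^sub>R \<xi> q))"
    by (rule field_scaleR[OF smooth_\<eta>[OF Y] field_scaleR[OF smooth_\<eta>[OF Z] field_\<xi>]])
qed

lemma field_nabla_\<phi>:
  assumes Y: "vector_field A Y" and Z: "vector_field A Z"
  shows "vector_field A (\<lambda>q. nabla_\<phi>_at q (Y q) (Z q))"
  unfolding nabla_\<phi>_decompose
  by (intro field_add field_const_scaleR nabla_\<phi>_summands assms)

text \<open>
  The first two terms on the right come from differentiating the arguments \<open>Y\<close> and \<open>Z\<close>; the last one
  is the covariant derivative of the tensor itself.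
\<close>

lemma D_nabla_\<phi>:
  assumes X: "vector_field A X" and Y: "vector_field A Y" and Z: "vector_field A Z"
  shows "D X (\<lambda>q. nabla_\<phi>_at q (Y q) (Z q)) p = nabla_\<phi>_at p (D X Y p) (Z p)
    + nabla_\<phi>_at p (Y p) (D X Z p) + nabla2_\<phi>_at p (X p) (Y p) (Z p)"
proof -
  note F = nabla_\<phi>_summands[OF Y Z]
  have sum: "D X (\<lambda>q. nabla_\<phi>_at q (Y q) (Z q)) p =
      - D X (\<lambda>q. g q (Y q) (Z q) *\<^sub>R \<xi> q) p - D X (\<lambda>q. \<eta> q (Z q) *\<^sub>R Y q) p
      + 2 *\<^sub>R D X (\<lambda>q. \<eta> q (Y q) *\<^sub>R (\<eta> q (Z q) *\<^sub>R \<xi> q)) p"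
    unfolding nabla_\<phi>_decompose
      D_add[OF X field_const_scaleR[OF F(1)]
        field_add[OF field_const_scaleR[OF F(2)] field_const_scaleR[OF F(3)]]]
      D_add[OF X field_const_scaleR[OF F(2)] field_const_scaleR[OF F(3)]]
      D_const_scaleR[OF X F(1)] D_const_scaleR[OF X F(2)] D_const_scaleR[OF X F(3)]
    by simp
  have 1: "D X (\<lambda>q. g q (Y q) (Z q) *\<^sub>R \<xi> q) p =
      (g p (D X Y p) (Z p) + g p (Y p) (D X Z p)) *\<^sub>R \<xi> p - g p (Y p) (Z p) *\<^sub>R \<phi> p (X p)"
    unfolding D_scaleR[OF smooth_metric[OF Y Z] X field_\<xi>] metric_compatible[OF X Y Z] D_\<xi>[OF X]
    by simp
  have 2: "D X (\<lambda>q. \<eta> q (Z q) *\<^sub>R Y q) p =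
      (\<eta> p (D X Z p) - g p (Z p) (\<phi> p (X p))) *\<^sub>R Y p + \<eta> p (Z p) *\<^sub>R D X Y p"
    unfolding D_scaleR[OF smooth_\<eta>[OF Z] X Y] derivative_\<eta>[OF X Z] ..
  have 3: "D X (\<lambda>q. \<eta> q (Y q) *\<^sub>R (\<eta> q (Z q) *\<^sub>R \<xi> q)) p =
      (\<eta> p (D X Y p) - g p (Y p) (\<phi> p (X p))) *\<^sub>R \<eta> p (Z p) *\<^sub>R \<xi> p
      + \<eta> p (Y p) *\<^sub>R ((\<eta> p (D X Z p) - g p (Z p) (\<phi> p (X p))) *\<^sub>R \<xi> p
      - \<eta> p (Z p) *\<^sub>R \<phi> p (X p))"
    unfolding D_scaleR[OF smooth_\<eta>[OF Y] X field_scaleR[OF smooth_\<eta>[OF Z] field_\<xi>]]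
      D_scaleR[OF smooth_\<eta>[OF Z] X field_\<xi>] derivative_\<eta>[OF X Y] derivative_\<eta>[OF X Z]
      D_\<xi>[OF X]
    by simp
  have sym: "g p (Z p) (\<phi> p (X p)) = g p (X p) (\<phi> p (Z p))"
    "g p (Y p) (\<phi> p (X p)) = g p (X p) (\<phi> p (Y p))"
    using X Y Z pt.g_sym[of "Z p" p "\<phi> p (X p)"] pt.g_sym[of "Y p" p "\<phi> p (X p)"]
    by (simp_all add: field_tangent)
  show ?thesis
    unfolding sum 1 2 3 sym
    by (simp add: pt.nabla_\<phi>_def pt.nabla2_\<phi>_def algebra_simps)
qed

text \<open>
  The Ricci identity for \<open>\<phi>\<close>: all first-order terms cancel upon antisymmetrising in \<open>X\<close> and \<open>Y\<close>.
\<close>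

lemma curvature_\<phi>:
  assumes X: "vector_field A X" and Y: "vector_field A Y" and Z: "vector_field A Z"
  shows "curvature_field D X Y (\<lambda>q. \<phi> q (Z q)) p = \<phi> p (curvature_field D X Y Z p)
    + (nabla2_\<phi>_at p (X p) (Y p) (Z p) - nabla2_\<phi>_at p (Y p) (X p) (Z p))"
proof -
  have second: "D X (D Y (\<lambda>q. \<phi> q (Z q))) p = \<phi> p (D X (D Y Z) p)
      + nabla_\<phi>_at p (X p) (D Y Z p) + nabla_\<phi>_at p (D X Y p) (Z p)
      + nabla_\<phi>_at p (Y p) (D X Z p) + nabla2_\<phi>_at p (X p) (Y p) (Z p)"
    if X: "vector_field A X" and Y: "vector_field A Y" for X Y
    unfolding D_\<phi>[OF Y Z] D_add[OF X field_\<phi>[OF field_D[OF Y Z]] field_nabla_\<phi>[OF Y Z]]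
      D_\<phi>[OF X field_D[OF Y Z]] D_nabla_\<phi>[OF X Y Z]
    by simp
  have "D (lie_bracket X Y) (\<lambda>q. \<phi> q (Z q)) p = \<phi> p (D (lie_bracket X Y) Z p)
      + nabla_\<phi>_at p (D X Y p - D Y X p) (Z p)"
    unfolding D_\<phi>[OF field_lie_bracket[OF X Y] Z] by (simp add: torsion_free[OF X Y])
  then show ?thesis
    using X Y Z
    by (simp add: curvature_field_def second[OF X Y] second[OF Y X] field_lie_bracket field_D
        field_tangent pt.nabla_\<phi>_diff_left)
qed

text \<open>
  The function \<open>f = g(Z, W)\<close> satisfies \<open>[X, Y] f = X (Y f) - Y (X f)\<close>. Expanding both sides with the
  compatibility of the connection and the metric leaves exactly the two curvature terms.
\<close>

lemma curvature_skew:
  assumes X: "vector_field A X" and Y: "vector_field A Y"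
    and Z: "vector_field A Z" and W: "vector_field A W"
  shows "g p (curvature_field D X Y Z p) (W p) + g p (Z p) (curvature_field D X Y W p) = 0"
proof -
  let ?f = "\<lambda>q. g q (Z q) (W q)"
  have second: "X p (\<lambda>q. Y q ?f) =
      g p (D X (D Y Z) p) (W p) + g p (D Y Z p) (D X W p)
      + (g p (D X Z p) (D Y W p) + g p (Z p) (D X (D Y W) p))"
    if X: "vector_field A X" and Y: "vector_field A Y" for X Y
  proof -
    have "(\<lambda>q. Y q ?f) = (\<lambda>q. g q (D Y Z q) (W q) + g q (Z q) (D Y W q))"
      by (rule ext) (rule metric_compatible[OF Y Z W])
    then have "X p (\<lambda>q. Y q ?f) =
        X p (\<lambda>q. g q (D Y Z q) (W q)) + X p (\<lambda>q. g q (Z q) (D Y W q))"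
      using tangent_add[OF atlas field_tangent[OF X] smooth_metric[OF field_D[OF Y Z] W]
          smooth_metric[OF Z field_D[OF Y W]]] by simp
    then show ?thesis
      using metric_compatible[OF X field_D[OF Y Z] W] metric_compatible[OF X Z field_D[OF Y W]]
      by simp
  qed
  have "g p (D (lie_bracket X Y) Z p) (W p) + g p (Z p) (D (lie_bracket X Y) W p) =
      X p (\<lambda>q. Y q ?f) - Y p (\<lambda>q. X q ?f)"
    using metric_compatible[OF field_lie_bracket[OF X Y] Z W, of p] by (simp add: lie_bracket_def)
  then show ?thesis
    using X Y Z W
    by (simp add: second[OF X Y] second[OF Y X] curvature_field_def field_tangent field_D
        field_lie_bracket)
qed

end

section \<open>Sectional curvatures in dimension three\<close>

locale sasaki_like_manifold_3 = sasaki_like_manifold A \<phi> \<xi> \<eta> g D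
  for A :: "('m::{t2_space, second_countable_topology}, 'e::euclidean_space) chart set"
    and \<phi> \<xi> \<eta> g D +
  assumes dim: "DIM('e) = 3"
begin

lemma curvature_field_eq:
  assumes X: "vector_field A X" and Y: "vector_field A Y" and Z: "vector_field A Z"
  shows "curvature_field D X Y Z p = model_curvature_at p (X p) (Y p) (Z p)"
proof -
  obtain e where e: "ordered_basis (tangent_space A p) DIM('e) e"
    by (rule tangent_basis[of p])
  show ?thesis
  proof (rule pt.model_curvature_eqI[where F = "{Z. vector_field A Z}" and val = "\<lambda>Z. Z p"
        and R = "\<lambda>Z. curvature_field D X Y Z p" and \<xi>' = \<xi> and \<phi>' = "\<lambda>Z q. \<phi> q (Z q)"
        and B = "e ` {..<3}"])
    show "card (e ` {..<3}) = 3" "span (e ` {..<3}) = tangent_space A p"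
      using e dim by (simp_all add: ordered_basis_def card_image)
    show "\<exists>Z\<in>{Z. vector_field A Z}. Z p = z" if "z \<in> tangent_space A p" for z
      using extend_tangent_vector[OF atlas that] by blast
    show "curvature_field D X Y Z p \<in> tangent_space A p" if "Z \<in> {Z. vector_field A Z}" for Z
      using that X Y by (simp add: curvature_field_def field_tangent field_D field_lie_bracket)
  qed (use X Y Z in \<open>simp_all add: field_tangent field_\<xi> field_\<phi> curvature_\<xi> curvature_\<phi> curvature_skew\<close>)
qed

lemma curvature_at_eq:
  assumes "x \<in> tangent_space A p" "y \<in> tangent_space A p" "z \<in> tangent_space A p"
  shows "curvature_at A D p x y z = model_curvature_at p x y z"
proof -
  obtain X Y Z where "vector_field A X" "X p = x" "vector_field A Y" "Y p = y"
    "vector_field A Z" "Z p = z"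
    using assms extend_tangent_vector[OF atlas] by metis
  then show ?thesis
    unfolding curvature_at_def
    by (intro the_equality exI[of _ X] exI[of _ Y] exI[of _ Z]) (auto simp: curvature_field_eq)
qed

text \<open>
  Every basis of a non-degenerate plane has a nonzero Gram determinant, so the quotient in the
  definition of the sectional curvature is \<open>c\<close> for all bases and the definite description denotes \<open>c\<close>.
\<close>

lemma sectional_curvature_eqI:
  assumes "is_section A g p \<beta>"
    and curv: "\<And>a b. a \<in> tangent_space A p \<Longrightarrow> b \<in> tangent_space A p \<Longrightarrow> span {a, b} = \<beta> \<Longrightarrow>
      g p (model_curvature_at p a b b) a = c * (g p a a * g p b b - (g p a b)\<^sup>2)"
  shows "sectional_curvature A g D p \<beta> = c"
proof -
  have \<beta>: "\<beta> \<subseteq> tangent_space A p" "subspace \<beta>" "dim \<beta> = 2"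
    and nondeg: "\<And>x. x \<in> \<beta> \<Longrightarrow> (\<And>y. y \<in> \<beta> \<Longrightarrow> g p x y = 0) \<Longrightarrow> x = 0"
    using assms(1) unfolding is_section_def by blast+
  have ratio: "curvature4 A g D p a b b a / (g p a a * g p b b - (g p a b)\<^sup>2) = c"
    if ab: "basis_pair \<beta> a b" for a b
  proof -
    have span: "span {a, b} = \<beta>" and indep: "independent {a, b}" "a \<noteq> b"
      using ab unfolding basis_pair_def by auto
    have "a \<in> \<beta>" "b \<in> \<beta>"
      using span_base[of _ "{a, b}"] span by auto
    then have in_tangent: "a \<in> tangent_space A p" "b \<in> tangent_space A p"
      using \<beta>(1) by auto
    have "g p a a * g p b b - (g p a b)\<^sup>2 \<noteq> 0"
      by (rule pt.gram_det_nonzero[OF in_tangent indep]) (use nondeg span in auto)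
    then show ?thesis
      using curv[OF in_tangent span] by (simp add: curvature4_def curvature_at_eq in_tangent)
  qed
  obtain B where B: "independent B" "span B = \<beta>" "card B = 2"
  proof -
    obtain B where "B \<subseteq> \<beta>" "independent B" "\<beta> \<subseteq> span B" "card B = dim \<beta>"
      using basis_exists by blast
    then show ?thesis
      using that[of B] \<beta> span_minimal by (metis subset_antisym)
  qed
  from B(3) obtain a b where "B = {a, b}" "a \<noteq> b"
    by (auto simp: card_2_iff)
  then have "basis_pair \<beta> a b"
    using B by (simp add: basis_pair_def)
  with ratio show ?thesis
    unfolding sectional_curvature_def by (intro the_equality) blast+
qed

text \<open>
  A plane that is its own image under \<open>\<phi>\<close> lies in the kernel of \<open>\<eta>\<close>, as \<open>\<eta> \<circ> \<phi> = 0\<close>.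
\<close>

lemma sectional_curvature_holomorphic:
  assumes "is_section A g p \<beta>" and "phi_holomorphic \<phi> p \<beta>"
  shows "sectional_curvature A g D p \<beta> = - 1"
proof (rule sectional_curvature_eqI[OF assms(1)])
  fix a b assume ab: "a \<in> tangent_space A p" "b \<in> tangent_space A p" "span {a, b} = \<beta>"
  have hol: "\<beta> = \<phi> p ` \<beta>"
    using assms(2) by (simp only: phi_holomorphic_def)
  have "\<eta> p x = 0" if x: "x \<in> \<beta>" for x
  proof -
    obtain y where y: "y \<in> \<beta>" "x = \<phi> p y"
      using subsetD[OF equalityD1[OF hol] x] by blast
    have "y \<in> tangent_space A p"
      using assms(1) y(1) unfolding is_section_def by blast
    then show ?thesis
      unfolding y(2) by simp
  qed
  moreover have "a \<in> \<beta>" "b \<in> \<beta>"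
    unfolding ab(3)[symmetric] by (simp_all add: span_base)
  ultimately have "\<eta> p a = 0" "\<eta> p b = 0"
    by simp_all
  with ab show "g p (model_curvature_at p a b b) a = - 1 * (g p a a * g p b b - (g p a b)\<^sup>2)"
    using pt.model_curvature_horizontal[of a p b] by simp
qed

lemma sectional_curvature_xi_section:
  assumes "is_section A g p \<beta>" and "xi_section \<xi> p \<beta>"
  shows "sectional_curvature A g D p \<beta> = 1"
proof (rule sectional_curvature_eqI[OF assms(1)])
  fix a b assume ab: "a \<in> tangent_space A p" "b \<in> tangent_space A p" "span {a, b} = \<beta>"
  obtain x where x: "span {x, \<xi> p} = \<beta>"
    using assms(2) unfolding xi_section_def basis_pair_def by blast
  have "\<xi> p \<in> \<beta>"
    unfolding x[symmetric] by (simp add: span_base)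
  with ab show "g p (model_curvature_at p a b b) a = 1 * (g p a a * g p b b - (g p a b)\<^sup>2)"
    using pt.model_curvature_vertical[of a p b] by simp
qed

end

theorem theorem3p5:
  fixes A :: "('m::{t2_space, second_countable_topology}, 'e::euclidean_space) chart set"
    and \<phi> :: "'m \<Rightarrow> 'm tangent \<Rightarrow> 'm tangent"
    and \<xi> :: "'m vfield"
    and \<eta> :: "'m \<Rightarrow> 'm tangent \<Rightarrow> real"
    and g :: "'m metric"
    and D :: "'m connection"
    and v :: "'m vfield"
  assumes "DIM('e) = 3"
    and "almost_contact_B_metric A \<phi> \<xi> \<eta> g"
    and "levi_civita_connection A g D"
    and "sasaki_like A \<phi> \<xi> \<eta> g D"
    and "vector_field A v"
    and "\<exists>lam mu nu. ricci_like_soliton A \<phi> \<eta> g D v lam mu nu"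
  shows "(\<forall>p \<beta>. is_section A g p \<beta> \<and> phi_holomorphic \<phi> p \<beta> \<longrightarrow>
            sectional_curvature A g D p \<beta> = - 1) \<and>
         (\<forall>p \<beta>. is_section A g p \<beta> \<and> xi_section \<xi> p \<beta> \<longrightarrow>
            sectional_curvature A g D p \<beta> = 1)"
proof -
  interpret sasaki_like_manifold_3 A \<phi> \<xi> \<eta> g D
    using assms(1-4) by unfold_locales
  show ?thesis
    using sectional_curvature_holomorphic sectional_curvature_xi_section by blast
qed

end
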